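(* Let $P$ be a lattice polygon, and let $f(P)$ be the number of maximal lattice triangulations of $P$ (equivalently, of unimodular triangulations of $P$). Then $$f(P) \le 2^{|E'|},$$ where $|E'|$ is the number of inner (non-boundary) edges in any unimodular triangulation of $P$. In particular, for all integers $m,n\ge 1$, the number $f(m,n)$ of unimodular triangulations of the grid $P_{m,n}=\{0,1,\dots,m\}\times\{0,1,\dots,n\}$ satisfies $$f(m,n) \le 2^{3mn-m-n} < 2^{3mn}.$$
   Context: A lattice polygon $P$ is a closed, not necessarily convex, polygon in $\mathbb{R}^2$ (the closed region bounded by a simple closed polygonal curve) with all vertices in $\mathbb{Z}^2$. A lattice triangulation of $P$ is a subdivision of $P$ into finitely many non-degenerate triangles with vertices in $\mathbb{Z}^2$, any two of which intersect in a common face (possibly empty). It is maximal if it uses all integer points, i.e. every point of $P\cap\mathbb{Z}^2$ is a vertex of the triangulation. It is unimodular if every triangle has area $\frac{1}{2}$; the maximal lattice triangulations are exactly the unimodular ones. An edge of a triangulation is a boundary edge if it is contained in the boundary of $P$, and an inner edge otherwise; $E'$ denotes the set of inner edges of a unimodular triangulation (the number $|E'|$ is the same for every unimodular triangulation of $P$). A triangulation of the grid $P_{m,n}$ means a triangulation of the lattice polygon that is its convex hull $[0,m]\times[0,n]$, so $f(m,n)=f([0,m]\times[0,n])$. Triangulations are counted as distinct if they are different as sets of triangles (no identification under symmetry). *)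

theory Defs
  imports "HOL-Analysis.Analysis"
begin

type_synonym plane = "real \<times> real"

definition lattice :: "plane set" where
  "lattice = \<int> \<times> \<int>"

text \<open>The piecewise linear path through the listed points. The path of the empty list is a dummy
  value; it is constant, so it never satisfies \<^const>\<open>simple_path\<close>.\<close>

fun polygonal_path :: "plane list \<Rightarrow> real \<Rightarrow> plane" where
  "polygonal_path [] = linepath 0 0"
| "polygonal_path [a] = linepath a a"
| "polygonal_path [a, b] = linepath a b"
| "polygonal_path (a # b # c # vs) = linepath a b +++ polygonal_path (b # c # vs)"

text \<open>The vertex list of a closed curve repeats its first point at the end. Points where the curve
  does not turn are allowed in the list, which does not affect the resulting class of regions.\<close>

definition lattice_polygon :: "plane set \<Rightarrow> bool" where
  "lattice_polygon P \<longleftrightarrow> (\<exists>vs. set vs \<subseteq> lattice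
      \<and> simple_path (polygonal_path vs)
      \<and> pathfinish (polygonal_path vs) = pathstart (polygonal_path vs)
      \<and> P = path_image (polygonal_path vs) \<union> inside (path_image (polygonal_path vs)))"

definition vertices :: "plane set \<Rightarrow> plane set" where
  "vertices t = {v. v extreme_point_of t}"

text \<open>A triangulation is given by its set of triangles (as closed regions). In the library, the
  condition in \<^const>\<open>triangulation\<close> that two members meet in a common face is stated for one of
  the two, but for all ordered pairs.\<close>

definition lattice_triangulation :: "plane set \<Rightarrow> plane set set \<Rightarrow> bool" where
  "lattice_triangulation P T \<longleftrightarrow> triangulation T
      \<and> (\<forall>t\<in>T. 2 simplex t \<and> vertices t \<subseteq> lattice)
      \<and> \<Union>T = P"

definition maximal_triangulation :: "plane set \<Rightarrow> plane set set \<Rightarrow> bool" where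
  "maximal_triangulation P T \<longleftrightarrow> lattice_triangulation P T
      \<and> P \<inter> lattice \<subseteq> (\<Union>t\<in>T. vertices t)"

definition unimodular_triangulation :: "plane set \<Rightarrow> plane set set \<Rightarrow> bool" where
  "unimodular_triangulation P T \<longleftrightarrow> lattice_triangulation P T
      \<and> (\<forall>t\<in>T. measure lebesgue t = 1 / 2)"

definition edges :: "plane set set \<Rightarrow> plane set set" where
  "edges T = {e. \<exists>t\<in>T. e edge_of t}"

definition inner_edges :: "plane set \<Rightarrow> plane set set \<Rightarrow> plane set set" where
  "inner_edges P T = {e \<in> edges T. \<not> e \<subseteq> frontier P}"

definition num_maximal_triangulations :: "plane set \<Rightarrow> nat" where
  "num_maximal_triangulations P = card {T. maximal_triangulation P T}"

definition grid :: "nat \<Rightarrow> nat \<Rightarrow> plane set" where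
  "grid m n = (\<lambda>(i, j). (real i, real j)) ` ({0..m} \<times> {0..n})"

definition num_grid_triangulations :: "nat \<Rightarrow> nat \<Rightarrow> nat" where
  "num_grid_triangulations m n = card {T. unimodular_triangulation (convex hull grid m n) T}"

lemma convex_hull_grid: "convex hull grid m n = {0..real m} \<times> {0..real n}"
proof -
  have "grid m n = (real ` {0..m}) \<times> (real ` {0..n})" by (auto simp: grid_def)
  moreover have "convex hull (real ` {0..k}) = {0..real k}" for k
  proof
    show "convex hull (real ` {0..k}) \<subseteq> {0..real k}" by (rule hull_minimal) auto
    have "{0..real k} = convex hull {0, real k}"
      by (simp add: segment_convex_hull[symmetric] closed_segment_eq_real_ivl)
    also have "\<dots> \<subseteq> convex hull (real ` {0..k})" by (rule hull_mono) (force simp: image_iff)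
    finally show "{0..real k} \<subseteq> convex hull (real ` {0..k})" .
  qed
  ultimately show ?thesis by (simp add: convex_hull_Times)
qed

lemma closed_segment_horizontal:
  fixes a b c :: real
  shows "closed_segment (a, c) (b, c) = closed_segment a b \<times> {c}"
proof -
  have "(1 - u) * c + u * c = c" for u
    by (simp add: algebra_simps)
  then show ?thesis
    by (auto simp: closed_segment_def)
qed

lemma closed_segment_vertical:
  fixes a b c :: real
  shows "closed_segment (c, a) (c, b) = {c} \<times> closed_segment a b"
proof -
  have "(1 - u) * c + u * c = c" for u
    by (simp add: algebra_simps)
  then show ?thesis
    by (auto simp: closed_segment_def)
qed

lemma lattice_polygon_grid:
  assumes "1 \<le> m" "1 \<le> n" shows "lattice_polygon (convex hull grid m n)"
proof -
  define a b where "a = real m" and "b = real n"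
  have ab: "0 < a" "0 < b" using assms by (auto simp: a_def b_def)
  let ?vs = "[(0,0),(a,0),(a,b),(0,b),(0,0)] :: plane list"
  let ?g = "polygonal_path ?vs"
  have im: "path_image ?g = ({0..a} \<times> {0,b}) \<union> ({0,a} \<times> {0..b})"
    using ab by (auto simp: path_image_join closed_segment_horizontal closed_segment_vertical closed_segment_eq_real_ivl)
  have fr: "path_image ?g = frontier ({0..a} \<times> {0..b})"
    unfolding im using ab by (auto simp: frontier_def interior_Times closure_Times)
  have "simple_path ?g"
    unfolding polygonal_path.simps
    apply (intro simple_path_join_loop arc_join arc_linepath)
    using ab by (auto simp: path_image_join closed_segment_horizontal closed_segment_vertical closed_segment_eq_real_ivl)
  moreover have "inside (path_image ?g) = interior ({0..a} \<times> {0..b})"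
    unfolding fr by (rule inside_frontier_eq_interior) (auto intro: bounded_Times convex_Times)
  moreover have "{0..a} \<times> {0..b} = path_image ?g \<union> interior ({0..a} \<times> {0..b})"
    unfolding im using ab by (auto simp: interior_Times)
  moreover have "set ?vs \<subseteq> lattice" by (auto simp: lattice_def a_def b_def)
  ultimately show ?thesis unfolding lattice_polygon_def convex_hull_grid a_def[symmetric] b_def[symmetric]
    by (intro exI[of _ ?vs]) auto
qed

end

theory Submission
  imports Defs
begin

text \<open>
  The triangles of a unimodular triangulation contain no half-integral points besides their vertices
  and the midpoints of their sides (\<open>half_lattice_point_of_unimodular_triangle\<close>). Hence the midpoints of
  the inner edges are the same for all unimodular triangulations of a region \<open>P\<close>: they are the
  half-integral, non-integral points in the interior of \<open>P\<close>. A triangulation is determined by the choice of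
  the edge through each of these points (\<open>triangulation_eq_if_same_inner_edges\<close>). The bound follows once the
  points are ordered so that, given the edges at all earlier points, at most two edges are possible
  at the next one (\<open>at_most_two_edges\<close>, \<open>card_decision_tree\<close>).

  Ordering the points by the values of a linear functional without ties has this property. Let two
  triangulations agree at all points before \<open>v\<close> and have different edges at \<open>v\<close>, with edge vectors \<open>d\<^sub>1\<close> and \<open>d\<^sub>2\<close>. The
  determinant of \<open>d\<^sub>1\<close> and \<open>d\<^sub>2\<close> is an even number, and the key claim is that it is \<open>\<plusminus>2\<close>, so that the two edges
  are the diagonals of a parallelogram of area 1 (\<open>first_difference\<close>). Otherwise the lattice line next to the
  first edge contains two neighbouring lattice points with the second edge strictly between them.
  These points and the ends of the first edge form a parallelogram, and the centre \<open>m\<close> of this parallelogram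
  is a half-integral point with a remarkable property: every lattice segment through \<open>m\<close> crosses one of
  the two edges at \<open>v\<close> (\<open>lattice_segment_crosses\<close>). So the triangulations cannot have the same edge at \<open>m\<close>,
  nor, by symmetry, at \<open>2v - m\<close> (\<open>obstructing_midpoint\<close>). One of these two points precedes \<open>v\<close>, a
  contradiction.

  Three different edges at \<open>v\<close> would therefore have edge vectors with pairwise determinants \<open>\<plusminus>2\<close>. These
  vectors are congruent modulo twice the lattice, and a linear relation between them shows that one of
  them is twice a lattice vector, although edge vectors are primitive.

  Maximal and unimodular triangulations coincide because a lattice triangle has area \<open>1/2\<close> if and only if
  its vertices are its only lattice points. For the grid it remains to count the half-integral points.
\<close>

section \<open>Orientation and triangles in the plane\<close>

definition cross :: "plane \<Rightarrow> plane \<Rightarrow> real" where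
  "cross p q = fst p * snd q - snd p * fst q"

text \<open>Twice the signed area of the triangle with vertices \<open>a\<close>, \<open>b\<close>, \<open>c\<close>.\<close>

definition orient :: "plane \<Rightarrow> plane \<Rightarrow> plane \<Rightarrow> real" where
  "orient a b c = cross (b - a) (c - a)"

lemma lattice_iff: "p \<in> lattice \<longleftrightarrow> fst p \<in> \<int> \<and> snd p \<in> \<int>"
  by (cases p) (auto simp: lattice_def)

lemma lattice_add: "p \<in> lattice \<Longrightarrow> q \<in> lattice \<Longrightarrow> p + q \<in> lattice"
  and lattice_diff: "p \<in> lattice \<Longrightarrow> q \<in> lattice \<Longrightarrow> p - q \<in> lattice"
  and lattice_scaleR: "k \<in> \<int> \<Longrightarrow> p \<in> lattice \<Longrightarrow> k *\<^sub>R p \<in> lattice"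
  by (auto simp: lattice_iff)

lemma half_not_Ints: "(1/2 :: real) \<notin> \<int>"
proof
  assume "(1/2 :: real) \<in> \<int>"
  then obtain k :: int where "1/2 = real_of_int k" by (auto elim: Ints_cases)
  then have "real_of_int (2 * k) = 1" by simp
  then have "2 * k = 1" by linarith
  then show False by presburger
qed

lemma cross_Ints: "p \<in> lattice \<Longrightarrow> q \<in> lattice \<Longrightarrow> cross p q \<in> \<int>"
  by (auto simp: lattice_iff cross_def)

lemma orient_Ints: "a \<in> lattice \<Longrightarrow> b \<in> lattice \<Longrightarrow> c \<in> lattice \<Longrightarrow> orient a b c \<in> \<int>"
  by (auto simp: orient_def intro!: cross_Ints lattice_diff)

lemma cross_scaleR [simp]:
  "cross (k *\<^sub>R p) q = k * cross p q" "cross p (k *\<^sub>R q) = k * cross p q"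
  by (auto simp: cross_def algebra_simps)

lemma cross_add: "cross (p + p') q = cross p q + cross p' q" "cross p (q + q') = cross p q + cross p q'"
  and cross_diff: "cross (p - p') q = cross p q - cross p' q" "cross p (q - q') = cross p q - cross p q'"
  and cross_self: "cross p p = 0"
  by (auto simp: cross_def algebra_simps)

lemma cross_swap: "cross q p = - cross p q"
  by (auto simp: cross_def)

lemma continuous_on_cross [continuous_intros]:
  fixes f g :: "'a::topological_space \<Rightarrow> plane"
  shows "continuous_on S f \<Longrightarrow> continuous_on S g \<Longrightarrow> continuous_on S (\<lambda>x. cross (f x) (g x))"
  unfolding cross_def by (intro continuous_intros)

lemma continuous_on_orient [continuous_intros]:
  fixes f g h :: "'a::topological_space \<Rightarrow> plane"
  shows "continuous_on S f \<Longrightarrow> continuous_on S g \<Longrightarrow> continuous_on S h \<Longrightarrow>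
    continuous_on S (\<lambda>x. orient (f x) (g x) (h x))"
  unfolding orient_def by (intro continuous_intros)

lemma orient_rotate: "orient a b c = orient b c a"
  and orient_swap: "orient a b c = - orient b a c"
  by (auto simp: orient_def cross_def algebra_simps)

lemma orient_same [simp]: "orient a a c = 0" "orient a b b = 0" "orient a b a = 0"
  by (auto simp: orient_def cross_def)

text \<open>Cramer's rule: the signed areas of the three triangles which a point spans with the sides are
  its barycentric coordinates, up to the factor \<^term>\<open>orient a b c\<close>.\<close>

lemma orient_sum: "orient x b c + orient a x c + orient a b x = orient a b c"
  by (auto simp: orient_def cross_def algebra_simps)

lemma orient_barycentric:
  "orient a b c *\<^sub>R x = orient x b c *\<^sub>R a + orient a x c *\<^sub>R b + orient a b x *\<^sub>R c"
  by (auto simp: orient_def cross_def prod_eq_iff algebra_simps)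

lemma orient_combination:
  assumes "u + v + w = 1"
  shows "orient (u *\<^sub>R a + v *\<^sub>R b + w *\<^sub>R c) b c = u * orient a b c"
    and "orient a (u *\<^sub>R a + v *\<^sub>R b + w *\<^sub>R c) c = v * orient a b c"
    and "orient a b (u *\<^sub>R a + v *\<^sub>R b + w *\<^sub>R c) = w * orient a b c"
proof -
  have u: "u = 1 - v - w" using assms by simp
  show "orient (u *\<^sub>R a + v *\<^sub>R b + w *\<^sub>R c) b c = u * orient a b c"
    "orient a (u *\<^sub>R a + v *\<^sub>R b + w *\<^sub>R c) c = v * orient a b c"
    "orient a b (u *\<^sub>R a + v *\<^sub>R b + w *\<^sub>R c) = w * orient a b c"
    unfolding u by (auto simp: orient_def cross_def algebra_simps)
qed

lemma orient_on_closed_segment: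
  assumes "x \<in> closed_segment a b"
  shows "orient a b x = 0"
proof -
  obtain u where "x = (1 - u) *\<^sub>R a + u *\<^sub>R b" using assms by (auto simp: in_segment)
  then have "x = (1 - u) *\<^sub>R a + u *\<^sub>R b + 0 *\<^sub>R 0" by simp
  then show ?thesis using orient_combination(3)[of "1 - u" u 0 a b 0] by simp
qed

lemma orient_on_open_segment:
  assumes "orient a b c \<noteq> 0" "p \<in> open_segment a b"
  shows "orient p b c / orient a b c > 0" "orient a p c / orient a b c > 0" "orient a b p = 0"
proof -
  obtain u where u: "0 < u" "u < 1" "p = (1 - u) *\<^sub>R a + u *\<^sub>R b"
    using assms(2) by (auto simp: in_segment)
  have p: "p = (1 - u) *\<^sub>R a + u *\<^sub>R b + 0 *\<^sub>R c" using u by simp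
  show "orient p b c / orient a b c > 0" "orient a p c / orient a b c > 0" "orient a b p = 0"
    using orient_combination[of "1 - u" u 0 a b c] u assms(1) unfolding p[symmetric] by auto
qed

lemma mem_triangle_iff:
  assumes "orient a b c > 0"
  shows "x \<in> convex hull {a, b, c} \<longleftrightarrow>
    0 \<le> orient x b c \<and> 0 \<le> orient a x c \<and> 0 \<le> orient a b x"
proof
  assume "x \<in> convex hull {a, b, c}"
  then obtain u v w where uvw: "0 \<le> u" "0 \<le> v" "0 \<le> w" "u + v + w = 1"
    and x: "x = u *\<^sub>R a + v *\<^sub>R b + w *\<^sub>R c"
    by (auto simp: convex_hull_3)
  show "0 \<le> orient x b c \<and> 0 \<le> orient a x c \<and> 0 \<le> orient a b x"
    unfolding x orient_combination[OF uvw(4)] using uvw assms by auto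
next
  assume *: "0 \<le> orient x b c \<and> 0 \<le> orient a x c \<and> 0 \<le> orient a b x"
  let ?d = "orient a b c"
  have "x = (1 / ?d) *\<^sub>R (?d *\<^sub>R x)" using assms by simp
  also have "\<dots> = (orient x b c / ?d) *\<^sub>R a + (orient a x c / ?d) *\<^sub>R b + (orient a b x / ?d) *\<^sub>R c"
    using orient_barycentric[of a b c x] by (simp add: scaleR_add_right)
  finally have "x = (orient x b c / ?d) *\<^sub>R a + (orient a x c / ?d) *\<^sub>R b + (orient a b x / ?d) *\<^sub>R c" .
  moreover have "orient x b c / ?d + orient a x c / ?d + orient a b x / ?d = 1"
    using orient_sum[of x b c a] assms by (simp add: field_simps)
  ultimately show "x \<in> convex hull {a, b, c}"
    using * assms unfolding convex_hull_3 mem_Collect_eq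
    by (intro exI[of _ "orient x b c / ?d"] exI[of _ "orient a x c / ?d"] exI[of _ "orient a b x / ?d"]) auto
qed

lemma orient_zero_collinear: "orient a b c = 0 \<longleftrightarrow> collinear {a, b, c}"
proof -
  have eq: "cross p q = 0 \<longleftrightarrow> collinear {0, p, q}" for p q
  proof
    assume *: "cross p q = 0"
    show "collinear {0, p, q}"
    proof (cases "fst p = 0")
      case True
      show ?thesis
      proof (cases "snd p = 0")
        case False
        with True * have "q = (snd q / snd p) *\<^sub>R p"
          by (auto simp: cross_def prod_eq_iff)
        then show ?thesis unfolding collinear_lemma by blast
      qed (use True in \<open>auto simp: collinear_lemma prod_eq_iff\<close>)
    next
      case False
      with * have "q = (fst q / fst p) *\<^sub>R p"
        by (auto simp: cross_def prod_eq_iff field_simps)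
      then show ?thesis unfolding collinear_lemma by blast
    qed
  qed (auto simp: collinear_lemma cross_def)
  have "orient a b c = - cross (a - b) (c - b)"
    by (auto simp: orient_def cross_def algebra_simps)
  then show ?thesis using eq[of "a - b" "c - b"] by (simp add: collinear_3[of a b c])
qed

lemma orient_nonzero_affine_independent:
  assumes "orient a b c \<noteq> 0"
  shows "\<not> affine_dependent {a, b, c}" "a \<noteq> b" "a \<noteq> c" "b \<noteq> c"
  using assms collinear_3_eq_affine_dependent[of a b c] orient_zero_collinear[of a b c] by auto

lemma vertices_triangle: "orient a b c \<noteq> 0 \<Longrightarrow> vertices (convex hull {a, b, c}) = {a, b, c}"
  using extreme_point_of_convex_hull_affine_independent[of "{a,b,c}"]
    orient_nonzero_affine_independent(1)[of a b c] by (auto simp: vertices_def)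

lemma triangle_obtain:
  assumes "2 simplex t"
  obtains a b c where "t = convex hull {a, b, c}" "orient a b c > 0" "vertices t = {a, b, c}"
proof -
  obtain C where C: "\<not> affine_dependent C" "int (card C) = 2 + 1" "t = convex hull C"
    using assms unfolding simplex_def by blast
  then have "card C = 3" by simp
  then obtain a b c where abc: "C = {a, b, c}" "a \<noteq> b" "a \<noteq> c" "b \<noteq> c"
    by (auto simp: card_3_iff)
  then have "orient a b c \<noteq> 0"
    using C(1) orient_zero_collinear collinear_3_eq_affine_dependent by metis
  then consider "orient a b c > 0" | "orient b a c > 0"
    using orient_swap[of a b c] by linarith
  then show thesis
  proof cases
    case 1 then show thesis using that[of a b c] C(3) abc(1) vertices_triangle[of a b c] by simp
  next
    case 2
    have "C = {b, a, c}" unfolding abc(1) by (rule insert_commute)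
    with 2 show thesis using that[of b a c] C(3) vertices_triangle[of b a c] by simp
  qed
qed

lemma triangle_edge_obtain:
  assumes "orient a b c > 0" "e edge_of (convex hull {a, b, c})"
  obtains a' b' c' where "{a', b', c'} = {a, b, c}" "orient a' b' c' = orient a b c"
    "e = closed_segment a' b'"
proof -
  have ind: "\<not> affine_dependent {a, b, c}"
    using assms(1) by (intro orient_nonzero_affine_independent) simp
  have "e face_of (convex hull {a, b, c})" and dim: "aff_dim e = 1"
    using assms by (auto simp: edge_of_def)
  then obtain C where C: "C \<subseteq> {a, b, c}" "e = convex hull C"
    unfolding face_of_convex_hull_affine_independent[OF ind] by blast
  have "\<not> affine_dependent C"
    using C(1) ind affine_dependent_subset by blast
  then have "aff_dim C = int (card C) - 1"
    using aff_dim_affine_independent[of C] by simp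
  then have "card C = 2" using dim C(2) by (simp add: aff_dim_convex_hull)
  then obtain p q where pq: "C = {p, q}" "p \<noteq> q" by (auto simp: card_2_iff)
  have e: "e = closed_segment p q" using C pq by (simp add: segment_convex_hull)
  have "{p, q} = {a, b} \<or> {p, q} = {b, c} \<or> {p, q} = {c, a}"
    using C(1) pq unfolding pq(1) doubleton_eq_iff insert_subset by blast
  then consider "e = closed_segment a b" | "e = closed_segment b c" | "e = closed_segment c a"
    unfolding e closed_segment_eq by blast
  then show thesis
  proof cases
    case 1 then show thesis using that[of a b c] by simp
  next
    case 2 then show thesis using that[of b c a] orient_rotate[of a b c] by (simp add: insert_commute)
  next
    case 3 then show thesis using that[of c a b] orient_rotate[of c a b] by (simp add: insert_commute)
  qed
qed

lemma triangle_side_edge_of: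
  assumes "orient a b c \<noteq> 0"
  shows "closed_segment a b edge_of (convex hull {a, b, c})"
proof -
  note ind = orient_nonzero_affine_independent[OF assms]
  have "closed_segment a b face_of (convex hull {a, b, c})"
    unfolding segment_convex_hull face_of_convex_hull_affine_independent[OF ind(1)]
    by (intro exI[of _ "{a, b}"]) simp
  moreover have "aff_dim (closed_segment a b) = 1"
    unfolding segment_convex_hull aff_dim_convex_hull by (simp add: aff_dim_2 ind(2))
  ultimately show ?thesis by (simp add: edge_of_def)
qed

lemma triangle_sides_edge_of:
  assumes "orient a b c \<noteq> 0"
  shows "closed_segment a b edge_of (convex hull {a, b, c})"
    "closed_segment b c edge_of (convex hull {a, b, c})"
    "closed_segment c a edge_of (convex hull {a, b, c})"
proof -
  have sets: "{b, c, a} = {a, b, c}" "{c, a, b} = {a, b, c}" by auto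
  have "orient b c a \<noteq> 0" "orient c a b \<noteq> 0"
    using assms orient_rotate[of a b c] orient_rotate[of c a b] by linarith+
  from this[THEN triangle_side_edge_of]
  show "closed_segment b c edge_of (convex hull {a, b, c})"
    "closed_segment c a edge_of (convex hull {a, b, c})"
    unfolding sets .
qed (rule triangle_side_edge_of[OF assms])

lemma orient_zero_mem_side:
  assumes "orient a b c > 0" "x \<in> convex hull {a, b, c}" "orient a b x = 0"
  shows "x \<in> closed_segment a b"
proof -
  obtain u v w where uvw: "0 \<le> u" "0 \<le> v" "0 \<le> w" "u + v + w = 1"
    and x: "x = u *\<^sub>R a + v *\<^sub>R b + w *\<^sub>R c"
    using assms(2) by (auto simp: convex_hull_3)
  have "w = 0" using assms(1,3) orient_combination(3)[OF uvw(4), of a b c] x by simp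
  with uvw have "u = 1 - v" "v \<le> 1" by linarith+
  then have "x = (1 - v) *\<^sub>R a + v *\<^sub>R b" unfolding x \<open>w = 0\<close> by simp
  then show ?thesis using uvw(2) \<open>v \<le> 1\<close> by (auto simp: closed_segment_def)
qed

lemma triangle_interior_or_edge:
  assumes "orient a b c > 0" "x \<in> convex hull {a, b, c}"
  shows "x \<in> interior (convex hull {a, b, c}) \<or> (\<exists>e. e edge_of (convex hull {a, b, c}) \<and> x \<in> e)"
proof (cases "orient x b c > 0 \<and> orient a x c > 0 \<and> orient a b x > 0")
  case True
  let ?U = "{y. 0 < orient y b c} \<inter> {y. 0 < orient a y c} \<inter> {y. 0 < orient a b y}"
  have "open ?U"
    by (intro open_Int open_Collect_less continuous_intros)
  moreover have "?U \<subseteq> convex hull {a, b, c}" by (auto simp: mem_triangle_iff[OF assms(1)])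
  ultimately have "?U \<subseteq> interior (convex hull {a, b, c})" by (rule interior_maximal[rotated])
  then show ?thesis using True by auto
next
  case False
  have sets: "{b, c, a} = {a, b, c}" "{c, a, b} = {a, b, c}" by auto
  have pos: "orient b c a > 0" "orient c a b > 0"
    using assms(1) orient_rotate[of a b c] orient_rotate[of c a b] by linarith+
  from False assms(2) have "orient x b c = 0 \<or> orient a x c = 0 \<or> orient a b x = 0"
    unfolding mem_triangle_iff[OF assms(1)] by linarith
  then have "orient b c x = 0 \<or> orient c a x = 0 \<or> orient a b x = 0"
    using orient_rotate[of x b c] orient_rotate[of c a x] by linarith
  then have "x \<in> closed_segment b c \<or> x \<in> closed_segment c a \<or> x \<in> closed_segment a b"
    using orient_zero_mem_side[OF assms] orient_zero_mem_side[OF pos(1), of x]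
      orient_zero_mem_side[OF pos(2), of x] assms(2) unfolding sets by blast
  moreover have "orient a b c \<noteq> 0" using assms(1) by simp
  ultimately show ?thesis using triangle_sides_edge_of[of a b c] by blast
qed

section \<open>Area and lattice points of lattice triangles\<close>

text \<open>The area formula for triangles is a statement about \<^typ>\<open>real^2\<close>. Since Lebesgue measure is
  characterised by its values on boxes, passing to coordinate pairs preserves it.\<close>

lemma lborel_plane: "(lborel :: plane measure) = distr lborel borel (\<lambda>x::real^2. (x $ 1, x $ 2))"
proof (rule lborel_eqI)
  fix l u :: plane
  assume le: "\<And>b. b \<in> Basis \<Longrightarrow> l \<bullet> b \<le> u \<bullet> b"
  have le': "fst l \<le> fst u" "snd l \<le> snd u"
    using le[of "(1, 0)"] le[of "(0, 1)"] by (auto simp: Basis_prod_def inner_prod_def)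
  define l' u' :: "real^2" where "l' = vector [fst l, snd l]" and "u' = vector [fst u, snd u]"
  have comp: "l' $ 1 = fst l" "l' $ 2 = snd l" "u' $ 1 = fst u" "u' $ 2 = snd u"
    by (simp_all add: l'_def u'_def)
  have Basis: "(Basis :: (real^2) set) = {axis 1 1, axis 2 1}"
    by (auto simp: Basis_vec_def UNIV_2)
  have ne: "axis 1 1 \<noteq> (axis 2 1 :: real^2)" by (simp add: axis_eq_axis)
  have pre: "(\<lambda>x::real^2. (x $ 1, x $ 2)) -` box l u = box l' u'"
    by (auto simp: mem_box Basis inner_axis comp Basis_prod_def inner_prod_def)
  have meas: "(\<lambda>x::real^2. (x $ 1, x $ 2)) \<in> borel_measurable lborel"
    by (auto intro!: borel_measurable_continuous_onI continuous_intros)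
  have "emeasure (distr lborel borel (\<lambda>x::real^2. (x $ 1, x $ 2))) (box l u) =
      emeasure lborel (box l' u')"
    using meas by (simp add: emeasure_distr pre)
  also have "\<dots> = (\<Prod>b\<in>Basis. (u' - l') \<bullet> b)"
    using le' by (intro emeasure_lborel_box) (auto simp: Basis inner_axis comp)
  also have "(\<Prod>b\<in>Basis. (u' - l') \<bullet> b) = (fst u - fst l) * (snd u - snd l)"
    using ne by (simp add: Basis inner_axis comp)
  also have "\<dots> = (\<Prod>b\<in>Basis. (u - l) \<bullet> b)"
    by (simp add: Basis_prod_def inner_prod_def)
  finally show "emeasure (distr lborel borel (\<lambda>x::real^2. (x $ 1, x $ 2))) (box l u) =
      (\<Prod>b\<in>Basis. (u - l) \<bullet> b)" .
qed simp

lemma area_triangle: "measure lebesgue (convex hull {a, b, c}) = \<bar>orient a b c\<bar> / 2"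
proof -
  let ?f = "\<lambda>x::real^2. (x $ 1, x $ 2)"
  have lin: "linear ?f" by (intro linearI) auto
  have meas: "?f \<in> borel_measurable lborel"
    by (auto intro!: borel_measurable_continuous_onI continuous_intros)
  define g :: "plane \<Rightarrow> real^2" where "g p = vector [fst p, snd p]" for p
  have g: "?f (g p) = p" "g p $ 1 = fst p" "g p $ 2 = snd p" for p by (simp_all add: g_def)
  have inj: "inj ?f" by (auto simp: inj_def vec_eq_iff forall_2)
  have "convex hull {a, b, c} = convex hull (?f ` {g a, g b, g c})" by (simp add: g)
  also have "\<dots> = ?f ` (convex hull {g a, g b, g c})"
    by (rule convex_hull_linear_image[OF lin, symmetric])
  finally have "?f -` (convex hull {a, b, c}) = convex hull {g a, g b, g c}"
    using inj by (simp add: inj_vimage_image_eq)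
  moreover have borel: "convex hull {a, b, c} \<in> sets borel"
    by (intro borel_closed compact_imp_closed finite_imp_compact_convex_hull) simp
  ultimately have "measure lborel (convex hull {a, b, c}) = measure lborel (convex hull {g a, g b, g c})"
    using meas by (subst lborel_plane) (simp add: measure_distr)
  then have "measure lborel (convex hull {a, b, c}) = \<bar>orient a b c\<bar> / 2"
    by (simp add: content_triangle g orient_def cross_def abs_minus_commute algebra_simps)
  then show ?thesis using borel by (simp add: measure_completion)
qed

lemma convex_hull_triangle_point:
  assumes "0 \<le> s" "0 \<le> t" "s + t \<le> (1::real)"
  shows "a + s *\<^sub>R (b - a) + t *\<^sub>R (c - a) \<in> convex hull {a, b, c :: plane}"
  unfolding convex_hull_3 mem_Collect_eq using assms
  by (intro exI[of _ "1 - s - t"] exI[of _ s] exI[of _ t]) (auto simp: algebra_simps)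

text \<open>If the edge vectors at \<open>a\<close> did not generate the
  lattice, some lattice vector would have a nonzero remainder in the fundamental parallelogram they
  span. The diagonal cuts this parallelogram into the triangle and its mirror image, so the remainder or
  its mirror image would give a lattice point of the triangle other than a vertex.\<close>

lemma empty_triangle_unimodular:
  assumes lat: "a \<in> lattice" "b \<in> lattice" "c \<in> lattice"
    and pos: "orient a b c > 0"
    and empty: "convex hull {a, b, c} \<inter> lattice \<subseteq> {a, b, c}"
  shows "orient a b c = 1"
proof -
  let ?d = "orient a b c"
  let ?s = "\<lambda>p. cross p (c - a) / ?d" and ?t = "\<lambda>p. cross (b - a) p / ?d"
  have decomp: "p = ?s p *\<^sub>R (b - a) + ?t p *\<^sub>R (c - a)" for p
  proof -
    have "?d *\<^sub>R p = cross p (c - a) *\<^sub>R (b - a) + cross (b - a) p *\<^sub>R (c - a)"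
      by (auto simp: orient_def cross_def prod_eq_iff algebra_simps)
    then have "(1 / ?d) *\<^sub>R ?d *\<^sub>R p = ?s p *\<^sub>R (b - a) + ?t p *\<^sub>R (c - a)"
      by (simp only: scaleR_add_right scaleR_scaleR) simp
    then show ?thesis using pos by simp
  qed
  have coeffs: "cross (s *\<^sub>R (b - a) + t *\<^sub>R (c - a)) (c - a) = s * ?d"
    "cross (b - a) (s *\<^sub>R (b - a) + t *\<^sub>R (c - a)) = t * ?d" for s t
    by (auto simp: orient_def cross_def algebra_simps)
  have ints: "?s p \<in> \<int> \<and> ?t p \<in> \<int>" if p: "p \<in> lattice" for p
  proof -
    define s t where "s = frac (?s p)" and "t = frac (?t p)"
    define q where "q = s *\<^sub>R (b - a) + t *\<^sub>R (c - a)"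
    have st: "0 \<le> s" "s < 1" "0 \<le> t" "t < 1" by (auto simp: s_def t_def frac_lt_1)
    have "q = p - (of_int \<lfloor>?s p\<rfloor> *\<^sub>R (b - a) + of_int \<lfloor>?t p\<rfloor> *\<^sub>R (c - a))"
      using decomp[of p] by (simp add: q_def s_def t_def frac_def algebra_simps)
    then have q: "q \<in> lattice"
      using p lat by (auto intro!: lattice_diff lattice_add lattice_scaleR)
    have st_of_q: "s = ?s q" "t = ?t q"
      using pos by (simp_all add: q_def coeffs)
    have small: "s' = 0 \<and> t' = 0 \<or> s' = 1 \<or> t' = 1"
      if "0 \<le> s'" "0 \<le> t'" "s' + t' \<le> 1" "s' *\<^sub>R (b - a) + t' *\<^sub>R (c - a) \<in> lattice" for s' t'
    proof -
      let ?r = "s' *\<^sub>R (b - a) + t' *\<^sub>R (c - a)"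
      have "a + ?r \<in> convex hull {a, b, c} \<inter> lattice"
        using convex_hull_triangle_point[OF that(1-3), of a b c] lattice_add[OF lat(1) that(4)]
        by (simp add: add.assoc)
      then have "a + ?r \<in> {a, b, c}" using empty by blast
      then consider "?r = 0" | "?r = b - a" | "?r = c - a" by (auto simp: algebra_simps)
      then show ?thesis
      proof cases
        case 1
        have "s' * ?d = 0" "t' * ?d = 0"
          using coeffs[of s' t'] unfolding 1 by (simp_all add: cross_def)
        then show ?thesis using pos by simp
      next
        case 2
        then have "s' * ?d = ?d" using coeffs(1)[of s' t'] by (simp add: orient_def)
        then show ?thesis using pos by simp
      next
        case 3
        then have "t' * ?d = ?d" using coeffs(2)[of s' t'] by (simp add: orient_def)
        then show ?thesis using pos by simp
      qed
    qed
    have "s = 0 \<and> t = 0"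
    proof (cases "s + t \<le> 1")
      case True
      then show ?thesis using small[of s t] st q by (auto simp: q_def)
    next
      case False
      have "(1 - s) *\<^sub>R (b - a) + (1 - t) *\<^sub>R (c - a) = (b - a) + (c - a) - q"
        by (simp add: q_def algebra_simps)
      moreover have "\<dots> \<in> lattice" using q lat by (intro lattice_diff lattice_add)
      ultimately show ?thesis using small[of "1 - s" "1 - t"] st False by auto
    qed
    then show ?thesis by (simp add: s_def t_def)
  qed
  have e: "(1, 0) \<in> lattice" "(0, 1) \<in> lattice" by (auto simp: lattice_iff)
  define i j k l where "i = ?s (1,0)" and "j = ?t (1,0)" and "k = ?s (0,1)" and "l = ?t (0,1)"
  have int: "i * l - j * k \<in> \<int>" unfolding i_def j_def k_def l_def
    using ints[OF e(1)] ints[OF e(2)] by (intro Ints_diff Ints_mult) auto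
  have "cross (1,0) (0,1) = (i * l - j * k) * ?d"
    unfolding decomp[of "(1,0)", folded i_def j_def] decomp[of "(0,1)", folded k_def l_def]
    by (auto simp: orient_def cross_def algebra_simps)
  then have one: "(i * l - j * k) * ?d = 1" by (simp add: cross_def)
  obtain x y where xy: "i * l - j * k = of_int x" "?d = of_int y"
    using int orient_Ints[OF lat] by (metis Ints_cases)
  have "x * y = 1" using one unfolding xy by (metis of_int_1 of_int_eq_iff of_int_mult)
  then have "y = 1" using pos xy(2) by (auto simp: zmult_eq_1_iff)
  then show ?thesis using xy by simp
qed

text \<open>In a unimodular triangle the barycentric coordinates of a half-integral point are multiples of
  \<open>1/2\<close>, which leaves the three vertices and the three midpoints of the sides. This is why every
  half-integral point that is not integral has to be the midpoint of an edge.\<close>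

lemma half_lattice_point_of_unimodular_triangle:
  assumes lat: "a \<in> lattice" "b \<in> lattice" "c \<in> lattice"
    and one: "orient a b c = 1"
    and x: "x \<in> convex hull {a, b, c}" "2 *\<^sub>R x \<in> lattice"
  shows "x \<in> {a, b, c, midpoint a b, midpoint b c, midpoint c a}"
proof -
  let ?u = "orient x b c" and ?v = "orient a x c" and ?w = "orient a b x"
  have nonneg: "0 \<le> ?u" "0 \<le> ?v" "0 \<le> ?w" using x(1) one by (simp_all add: mem_triangle_iff)
  have sum: "?u + ?v + ?w = 1" using orient_sum[of x b c a] one by simp
  have rep: "x = ?u *\<^sub>R a + ?v *\<^sub>R b + ?w *\<^sub>R c" using orient_barycentric[of a b c x] one by simp
  have "2 * ?v = cross (2 *\<^sub>R x - 2 *\<^sub>R a) (c - a)" "2 * ?w = cross (b - a) (2 *\<^sub>R x - 2 *\<^sub>R a)"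
    by (auto simp: orient_def cross_def algebra_simps)
  moreover have "2 *\<^sub>R x - 2 *\<^sub>R a \<in> lattice" by (rule lattice_diff[OF x(2) lattice_scaleR[OF _ lat(1)]]) simp
  ultimately have "2 * ?v \<in> \<int>" "2 * ?w \<in> \<int>" using lat by (auto intro!: cross_Ints lattice_diff)
  then obtain j k where jk: "2 * ?v = of_int j" "2 * ?w = of_int k" by (metis Ints_cases)
  have "real_of_int j \<ge> 0" "real_of_int k \<ge> 0" "real_of_int (j + k) \<le> 2" using jk nonneg sum by auto
  then have "0 \<le> j" "0 \<le> k" "j + k \<le> 2" by linarith+
  then have "(j, k) \<in> {(0,0), (0,1), (0,2), (1,0), (1,1), (2,0)}" by auto
  moreover have "?v = of_int j / 2" "?w = of_int k / 2" "?u = 1 - of_int j / 2 - of_int k / 2"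
    using jk sum by auto
  from rep[unfolded this]
  have "x = (1 - of_int j / 2 - of_int k / 2) *\<^sub>R a + (of_int j / 2) *\<^sub>R b + (of_int k / 2) *\<^sub>R c" .
  ultimately show ?thesis
    unfolding midpoint_def by (auto simp: scaleR_add_right add.commute)
qed

lemma lattice_point_of_unimodular_triangle:
  assumes lat: "a \<in> lattice" "b \<in> lattice" "c \<in> lattice"
    and one: "orient a b c = 1"
    and x: "x \<in> convex hull {a, b, c}" "x \<in> lattice"
  shows "x \<in> {a, b, c}"
proof -
  let ?u = "orient x b c" and ?v = "orient a x c" and ?w = "orient a b x"
  have nonneg: "0 \<le> ?u" "0 \<le> ?v" "0 \<le> ?w" using x(1) one by (simp_all add: mem_triangle_iff)
  have sum: "?u + ?v + ?w = 1" using orient_sum[of x b c a] one by simp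
  have rep: "x = ?u *\<^sub>R a + ?v *\<^sub>R b + ?w *\<^sub>R c" using orient_barycentric[of a b c x] one by simp
  obtain j k where jk: "?v = of_int j" "?w = of_int k"
    using orient_Ints lat x(2) by (metis Ints_cases)
  have "real_of_int j \<ge> 0" "real_of_int k \<ge> 0" "real_of_int (j + k) \<le> 1" using jk nonneg sum by auto
  then have "0 \<le> j" "0 \<le> k" "j + k \<le> 1" by linarith+
  then have "(j, k) \<in> {(0,0), (0,1), (1,0)}" by auto
  moreover have "?u = 1 - of_int j - of_int k" using jk sum by auto
  ultimately show ?thesis using jk by (subst (1) rep) auto
qed

section \<open>Edges of unimodular triangulations\<close>

text \<open>A lattice point of a triangle \<open>t\<close> is a vertex of some triangle \<open>t'\<close>. As \<open>t\<close> and \<open>t'\<close> meet in a common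
  face, it is a vertex of \<open>t\<close> as well, so \<open>t\<close> has no lattice points besides its vertices.\<close>

lemma maximal_imp_unimodular:
  assumes max: "maximal_triangulation P T"
  shows "unimodular_triangulation P T"
proof -
  have LT: "lattice_triangulation P T" and V: "P \<inter> lattice \<subseteq> (\<Union>t\<in>T. vertices t)"
    using max by (auto simp: maximal_triangulation_def)
  have faces: "t \<inter> t' face_of t" if "t \<in> T" "t' \<in> T" for t t'
    using LT that by (auto simp: lattice_triangulation_def triangulation_def)
  have "measure lebesgue t = 1 / 2" if t: "t \<in> T" for t
  proof -
    have "2 simplex t" "vertices t \<subseteq> lattice" using LT t by (auto simp: lattice_triangulation_def)
    then obtain a b c where abc: "t = convex hull {a, b, c}" "orient a b c > 0" "vertices t = {a, b, c}"
      using triangle_obtain by metis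
    have lat: "a \<in> lattice" "b \<in> lattice" "c \<in> lattice"
      using \<open>vertices t \<subseteq> lattice\<close> abc(3) by auto
    have "x \<in> vertices t" if x: "x \<in> t" "x \<in> lattice" for x
    proof -
      have "x \<in> P" using x t LT by (auto simp: lattice_triangulation_def)
      then obtain t' where t': "t' \<in> T" "x \<in> vertices t'" using V x by blast
      then have "x extreme_point_of t'" "x \<in> t'" by (auto simp: vertices_def extreme_point_of_def)
      then have "x extreme_point_of (t' \<inter> t)"
        using extreme_point_of_face[OF faces[OF t'(1) t]] x by blast
      then show ?thesis
        using extreme_point_of_face[OF faces[OF t t'(1)]] by (simp add: vertices_def Int_commute)
    qed
    then have "convex hull {a, b, c} \<inter> lattice \<subseteq> {a, b, c}" using abc by auto
    from empty_triangle_unimodular[OF lat abc(2) this] show ?thesis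
      by (simp add: abc(1) area_triangle)
  qed
  then show ?thesis using LT by (simp add: unimodular_triangulation_def)
qed

context
  fixes P :: "plane set" and T :: "plane set set"
  assumes unimodular: "unimodular_triangulation P T"
begin

lemma finite_triangles: "finite T"
  and faces: "\<And>t t'. t \<in> T \<Longrightarrow> t' \<in> T \<Longrightarrow> t \<inter> t' face_of t"
  and Union_triangles: "\<Union>T = P"
  using unimodular
  by (auto simp: unimodular_triangulation_def lattice_triangulation_def triangulation_def)

lemma unimodular_triangle_obtain:
  assumes "t \<in> T"
  obtains a b c where "a \<in> lattice" "b \<in> lattice" "c \<in> lattice" "orient a b c = 1"
    "t = convex hull {a, b, c}" "vertices t = {a, b, c}"
proof -
  have "2 simplex t" "vertices t \<subseteq> lattice" and m: "measure lebesgue t = 1 / 2"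
    using unimodular assms by (auto simp: unimodular_triangulation_def lattice_triangulation_def)
  then obtain a b c where abc: "t = convex hull {a, b, c}" "orient a b c > 0" "vertices t = {a, b, c}"
    using triangle_obtain by metis
  moreover have "orient a b c = 1" using m abc by (simp add: area_triangle)
  ultimately show thesis using that[of a b c] \<open>vertices t \<subseteq> lattice\<close> by simp
qed

lemma triangle_with_side_obtain:
  assumes "t \<in> T" "e edge_of t"
  obtains a b c where "a \<in> lattice" "b \<in> lattice" "c \<in> lattice" "orient a b c = 1"
    "t = convex hull {a, b, c}" "e = closed_segment a b"
proof -
  obtain a b c where abc: "a \<in> lattice" "b \<in> lattice" "c \<in> lattice" "orient a b c = 1"
    "t = convex hull {a, b, c}"
    using unimodular_triangle_obtain[OF assms(1)] by metis
  have "orient a b c > 0" "e edge_of (convex hull {a, b, c})" using abc assms(2) by simp_all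
  then obtain a' b' c' where abc': "{a', b', c'} = {a, b, c}" "orient a' b' c' = orient a b c"
    "e = closed_segment a' b'"
    by (rule triangle_edge_obtain)
  have "{a', b', c'} \<subseteq> lattice" unfolding abc'(1) using abc by simp
  then have "a' \<in> lattice" "b' \<in> lattice" "c' \<in> lattice" by auto
  then show thesis using that[of a' b' c'] abc abc' by simp
qed

lemma triangle_props:
  assumes "t \<in> T"
  shows "t \<subseteq> P" "convex t" "closed t" "compact t" "interior t \<noteq> {}" "aff_dim t = 2"
proof -
  obtain a b c where abc: "orient a b c = 1" "t = convex hull {a, b, c}"
    using unimodular_triangle_obtain[OF assms] by metis
  show "t \<subseteq> P" using Union_triangles assms by auto
  show "convex t" "compact t" by (simp_all add: abc finite_imp_compact_convex_hull)
  then show "closed t" by (simp add: compact_imp_closed)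
  have "2 simplex t"
    using unimodular assms by (auto simp: unimodular_triangulation_def lattice_triangulation_def)
  then show dim: "aff_dim t = 2" by (rule aff_dim_simplex)
  then show "interior t \<noteq> {}"
    using \<open>convex t\<close> by (simp add: interior_rel_interior_gen rel_interior_eq_empty) auto
qed

lemma compact_region: "compact P"
  unfolding Union_triangles[symmetric]
  using finite_triangles triangle_props by (intro compact_Union) auto

lemma closed_region: "closed P"
  using compact_region by (rule compact_imp_closed)

text \<open>A face that contains a relatively interior point of \<open>e\<close> contains \<open>e\<close>; this applies to the common
  face of \<open>t\<close> and a triangle of which \<open>e\<close> is known to be an edge.\<close>

lemma triangles_at_rel_interior:
  assumes e: "e \<in> edges T" and p: "p \<in> rel_interior e" and t: "t \<in> T" "p \<in> t"
  shows "e edge_of t"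
proof -
  obtain t0 where t0: "t0 \<in> T" "e edge_of t0" using e by (auto simp: edges_def)
  then have sub: "e \<subseteq> t0" and face: "e face_of t0" and dim: "aff_dim e = 1"
    by (auto simp: edge_of_def face_of_imp_subset)
  have "p \<in> t0" using p sub rel_interior_subset by blast
  then have "e \<subseteq> t0 \<inter> t"
    using p t by (intro subset_of_face_of[OF faces[OF t0(1) t(1)] sub]) auto
  then have "e face_of t0 \<inter> t" by (intro face_of_subset[OF face]) auto
  moreover have "t0 \<inter> t face_of t" using faces[OF t(1) t0(1)] by (simp add: Int_commute)
  ultimately have "e face_of t" by (rule face_of_trans)
  then show ?thesis using dim by (simp add: edge_of_def)
qed

lemma edges_noncrossing:
  assumes "e \<in> edges T" "g \<in> edges T" "p \<in> rel_interior e" "p \<in> g"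
  shows "e = g"
proof (rule ccontr)
  assume ne: "e \<noteq> g"
  obtain t where t: "t \<in> T" "g edge_of t" using assms by (auto simp: edges_def)
  then have g: "g face_of t" "g \<subseteq> t" "aff_dim g = 1" "convex g"
    using face_of_imp_convex[of g t] face_of_imp_subset[of g t] by (simp_all add: edge_of_def)
  have "e edge_of t" using triangles_at_rel_interior assms t(1) g(2) by blast
  then have e: "e face_of t" "e \<subseteq> t" "aff_dim e = 1"
    using face_of_imp_subset by (auto simp: edge_of_def)
  have "e \<subseteq> g" using subset_of_face_of[OF g(1) e(2)] assms by blast
  then have "e face_of g" using face_of_subset[OF e(1)] g by blast
  then show False using face_of_aff_dim_lt[OF g(4)] ne e g by fastforce
qed

lemma triangles_with_common_interior_point:
  assumes "t \<in> T" "t' \<in> T" "p \<in> interior t" "p \<in> t'"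
  shows "t = t'"
proof -
  have "p \<in> rel_interior t" using assms(3) interior_subset_rel_interior by blast
  moreover have "p \<in> t" using assms(3) interior_subset by blast
  moreover have "t' \<inter> t face_of t'" "t \<inter> t' face_of t"
    using faces assms by auto
  ultimately have "t \<subseteq> t \<inter> t'"
    using assms by (intro subset_of_face_of[of "t \<inter> t'" t t]) auto
  then have "t face_of t'" using \<open>t' \<inter> t face_of t'\<close> by (simp add: Int_absorb1)
  then show ?thesis
    using face_of_aff_dim_lt[of t' t] triangle_props assms by force
qed

lemma edge_avoids_triangle_interior:
  assumes "t \<in> T" "e \<in> edges T"
  shows "e \<inter> interior t = {}"
proof (rule ccontr)
  assume "e \<inter> interior t \<noteq> {}"
  then obtain p where p: "p \<in> e" "p \<in> interior t" by blast
  obtain t' where t': "t' \<in> T" "e edge_of t'" using assms by (auto simp: edges_def)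
  then have "e face_of t" "aff_dim e = 1"
    using triangles_with_common_interior_point[OF assms(1) t'(1) p(2)] p edge_of_imp_subset
    by (auto simp: edge_of_def)
  moreover have "p \<in> rel_interior t" using p(2) interior_subset_rel_interior by blast
  ultimately have "t \<subseteq> e" using subset_of_face_of[of e t t] p by auto
  then have "aff_dim t \<le> aff_dim e" by (rule aff_dim_subset)
  then show False using triangle_props(6)[OF assms(1)] \<open>aff_dim e = 1\<close> by simp
qed

lemma mem_interior_or_edge:
  assumes "t \<in> T" "p \<in> t"
  shows "p \<in> interior t \<or> (\<exists>e. e edge_of t \<and> p \<in> e)"
proof -
  obtain a b c where "orient a b c = 1" "t = convex hull {a, b, c}"
    using unimodular_triangle_obtain[OF assms(1)] by metis
  then show ?thesis using triangle_interior_or_edge[of a b c p] assms by simp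
qed

lemma edge_obtain:
  assumes "e \<in> edges T"
  obtains a b c where "a \<in> lattice" "b \<in> lattice" "c \<in> lattice" "orient a b c = 1"
    "e = closed_segment a b" "rel_interior e = open_segment a b" "a \<noteq> b" "e \<subseteq> P"
proof -
  obtain t where t: "t \<in> T" "e edge_of t" using assms by (auto simp: edges_def)
  obtain a b c where abc: "a \<in> lattice" "b \<in> lattice" "c \<in> lattice" "orient a b c = 1"
    "t = convex hull {a, b, c}" "e = closed_segment a b"
    using triangle_with_side_obtain[OF t] by metis
  have "a \<noteq> b" using abc(4) by auto
  moreover have "e \<subseteq> P" using t triangle_props(1) edge_of_imp_subset by blast
  ultimately show thesis using that abc by (simp add: rel_interior_closed_segment)
qed

lemma locally_triangles_at:
  obtains r where "r > 0" "\<And>t x. t \<in> T \<Longrightarrow> x \<in> t \<Longrightarrow> x \<in> ball p r \<Longrightarrow> p \<in> t"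
proof -
  have "open (- \<Union>{t \<in> T. p \<notin> t})"
    using finite_triangles triangle_props by (intro open_Compl closed_Union) auto
  moreover have "p \<in> - \<Union>{t \<in> T. p \<notin> t}" by auto
  ultimately obtain r where "r > 0" "ball p r \<subseteq> - \<Union>{t \<in> T. p \<notin> t}"
    by (meson open_contains_ball)
  then show thesis using that by blast
qed

text \<open>Near any relatively interior point of an edge only the triangles having this edge matter. An
  interior point \<open>q\<close> of the region forces such triangles on both sides of the edge, and then these two
  triangles together are a neighbourhood of every relatively interior point of the edge.\<close>

lemma edge_inside_if_one_point_inside:
  assumes e: "e \<in> edges T" and q: "q \<in> rel_interior e" "q \<in> interior P"
  shows "rel_interior e \<subseteq> interior P"
proof
  fix p assume p: "p \<in> rel_interior e"
  obtain a b c0 where ab: "a \<in> lattice" "b \<in> lattice" "orient a b c0 = 1"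
    "e = closed_segment a b" "rel_interior e = open_segment a b" "a \<noteq> b"
    using edge_obtain[OF e] by metis
  obtain r where r: "r > 0" "\<And>t x. t \<in> T \<Longrightarrow> x \<in> t \<Longrightarrow> x \<in> ball q r \<Longrightarrow> q \<in> t"
    by (rule locally_triangles_at[of q]) blast
  obtain r' where r': "r' > 0" "ball q r' \<subseteq> P" using q(2) by (meson mem_interior)
  \<comment> \<open>A point slightly off \<open>q\<close>, on the side of the edge that the sign \<open>s\<close> selects, lies in a triangle
    which also contains \<open>q\<close>.\<close>
  have side: "\<exists>c. convex hull {a, b, c} \<in> T \<and> s * orient a b c > 0" if s: "\<bar>s\<bar> = 1" for s :: real
  proof -
    define n where "n = s *\<^sub>R (c0 - a)"
    define \<delta> where "\<delta> = min r r' / (2 * (norm n + 1))"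
    define x where "x = q + \<delta> *\<^sub>R n"
    have n1: "norm n + 1 > 0" by (smt (verit) norm_ge_zero)
    then have \<delta>: "\<delta> > 0" using r r' by (simp add: \<delta>_def)
    have "dist q x = \<delta> * norm n" using \<delta> by (simp add: x_def dist_norm)
    also have "\<dots> \<le> \<delta> * (norm n + 1)" using \<delta> by simp
    also have "\<dots> = min r r' / 2" using n1 unfolding \<delta>_def by (simp add: divide_simps)
    also have "\<dots> < min r r'" using r(1) r'(1) by linarith
    finally have x: "x \<in> ball q r" "x \<in> ball q r'" by auto
    then have "x \<in> P" using r' by blast
    then obtain t where t: "t \<in> T" "x \<in> t" using Union_triangles by blast
    have "q \<in> t" using r(2) t x by blast
    then have "e edge_of t" using triangles_at_rel_interior e q t by blast
    then obtain a' b' c' where abc: "orient a' b' c' = 1" "t = convex hull {a', b', c'}"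
      "e = closed_segment a' b'"
      using triangle_with_side_obtain[OF t(1)] by metis
    then have "{a, b} = {a', b'}" using ab(4) closed_segment_eq by metis
    then have ab': "a = a' \<and> b = b' \<or> a = b' \<and> b = a'" by (auto simp: doubleton_eq_iff)
    then have hull: "t = convex hull {a, b, c'}" using abc(2) by (auto simp: insert_commute)
    have "orient a b q = 0" using orient_on_open_segment(3)[of a b c0 q] ab q by simp
    moreover have "orient a b x = orient a b q + \<delta> * s * orient a b c0"
      by (simp add: orient_def x_def n_def cross_def algebra_simps)
    ultimately have "orient a b x = \<delta> * s" using ab(3) by simp
    moreover obtain u v w where uvw: "0 \<le> u" "0 \<le> v" "0 \<le> w" "u + v + w = 1"
      and "x = u *\<^sub>R a + v *\<^sub>R b + w *\<^sub>R c'"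
      using t(2) unfolding hull convex_hull_3 by blast
    ultimately have "w * orient a b c' = \<delta> * s" using orient_combination(3)[OF uvw(4), of a b c'] by simp
    then have "w * (s * orient a b c') = \<delta> * (s * s)" by (simp add: algebra_simps)
    moreover have "s * s = 1" using s by (auto simp: abs_if split: if_splits)
    ultimately have "w * (s * orient a b c') > 0" using \<delta> by simp
    then have "s * orient a b c' > 0" using uvw(3) by (simp add: zero_less_mult_iff)
    then show ?thesis using hull t(1) by blast
  qed
  obtain c where c: "convex hull {a, b, c} \<in> T" "orient a b c > 0" using side[of 1] by auto
  obtain d where d: "convex hull {b, a, d} \<in> T" "orient b a d > 0"
    using side[of "-1"] orient_swap[of a b] by (auto simp: insert_commute)
  let ?U = "{x. 0 < orient x b c} \<inter> {x. 0 < orient a x c} \<inter> ({x. 0 < orient x a d} \<inter> {x. 0 < orient b x d})"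
  have "open ?U" by (intro open_Int open_Collect_less continuous_intros)
  moreover have "p \<in> ?U"
    using p orient_on_open_segment[of a b c p] orient_on_open_segment[of b a d p] c d ab(5)
    by (auto simp: zero_less_divide_iff open_segment_commute)
  moreover have "?U \<subseteq> P"
  proof
    fix x assume x: "x \<in> ?U"
    have "x \<in> convex hull {a, b, c} \<or> x \<in> convex hull {b, a, d}"
    proof (cases "orient a b x \<ge> 0")
      case True
      then show ?thesis using x mem_triangle_iff[OF c(2), of x] by auto
    next
      case False
      then have "orient b a x \<ge> 0" using orient_swap[of a b x] by simp
      then show ?thesis using x mem_triangle_iff[OF d(2), of x] by auto
    qed
    then show "x \<in> P" using c d triangle_props(1) by blast
  qed
  ultimately show "p \<in> interior P" by (meson interiorI)
qed

text \<open>Boundary edges and inner edges are thus told apart by a single point, in particular by the midpoint.\<close>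

lemma rel_interior_edge_cases:
  assumes "e \<in> edges T"
  shows "rel_interior e \<subseteq> interior P \<or> e \<subseteq> frontier P"
proof (cases "rel_interior e \<inter> interior P = {}")
  case True
  obtain a b c where ab: "a \<in> lattice" "b \<in> lattice" "orient a b c = 1"
    "e = closed_segment a b" "rel_interior e = open_segment a b" "a \<noteq> b" "e \<subseteq> P"
    using edge_obtain[OF assms] by metis
  have "rel_interior e \<subseteq> frontier P"
    using True ab(7) rel_interior_subset[of e] closed_region by (auto simp: frontier_def)
  then have "closure (open_segment a b) \<subseteq> frontier P"
    unfolding ab(5) by (intro closure_minimal) auto
  then show ?thesis using ab by simp
qed (use edge_inside_if_one_point_inside[OF assms] in blast)

end

lemma unimodular_imp_maximal:
  assumes T: "unimodular_triangulation P T"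
  shows "maximal_triangulation P T"
  unfolding maximal_triangulation_def
proof (intro conjI subsetI)
  show "lattice_triangulation P T" using T by (simp add: unimodular_triangulation_def)
  fix x assume x: "x \<in> P \<inter> lattice"
  then obtain t where t: "t \<in> T" "x \<in> t" using Union_triangles[OF T] by blast
  then show "x \<in> (\<Union>t\<in>T. vertices t)"
    using x lattice_point_of_unimodular_triangle unimodular_triangle_obtain[OF T t(1)]
    by (metis IntD2 UN_I)
qed

section \<open>Midpoints of inner edges\<close>

text \<open>These points depend on the region only, yet they are the midpoints of the inner edges of every
  unimodular triangulation of it. They serve as the common index set along which triangulations are
  compared.\<close>

definition edge_midpoints :: "plane set \<Rightarrow> plane set" where
  "edge_midpoints P = {v \<in> interior P. v \<notin> lattice \<and> 2 *\<^sub>R v \<in> lattice}"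

definition edge_at :: "plane set set \<Rightarrow> plane \<Rightarrow> plane set" where
  "edge_at T v = (THE e. e \<in> edges T \<and> v \<in> e)"

context
  fixes P :: "plane set" and T :: "plane set set"
  assumes unimodular: "unimodular_triangulation P T"
begin

lemma edge_at_props:
  assumes v: "v \<in> edge_midpoints P"
  shows "edge_at T v \<in> edges T" "v \<in> edge_at T v"
    and "\<And>e. e \<in> edges T \<Longrightarrow> v \<in> e \<Longrightarrow> e = edge_at T v"
proof -
  have v': "v \<in> interior P" "v \<notin> lattice" "2 *\<^sub>R v \<in> lattice"
    using v by (auto simp: edge_midpoints_def)
  have unique: "e = g" if eg: "e \<in> edges T" "g \<in> edges T" "v \<in> e" "v \<in> g" for e g
  proof -
    obtain a b c where "a \<in> lattice" "b \<in> lattice" "e = closed_segment a b"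
      "rel_interior e = open_segment a b"
      using edge_obtain[OF unimodular eg(1)] by metis
    then have "v \<in> rel_interior e" using eg v' by (auto simp: open_segment_def)
    then show ?thesis using edges_noncrossing[OF unimodular] eg by blast
  qed
  have "v \<in> P" using v'(1) interior_subset by blast
  then obtain t where t: "t \<in> T" "v \<in> t" using Union_triangles[OF unimodular] by blast
  obtain a b c where abc: "a \<in> lattice" "b \<in> lattice" "c \<in> lattice" "orient a b c = 1"
    "t = convex hull {a, b, c}"
    using unimodular_triangle_obtain[OF unimodular t(1)] by metis
  have "v \<in> {a, b, c, midpoint a b, midpoint b c, midpoint c a}"
    using half_lattice_point_of_unimodular_triangle[OF abc(1-4)] t(2) abc(5) v'(3) by simp
  then have "v \<in> closed_segment a b \<or> v \<in> closed_segment b c \<or> v \<in> closed_segment c a"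
    using abc v'(2) by auto
  moreover have "orient a b c \<noteq> 0" using abc by simp
  ultimately have "\<exists>e. e edge_of t \<and> v \<in> e"
    using triangle_sides_edge_of[of a b c] abc(5) by blast
  then have ex: "\<exists>e. e \<in> edges T \<and> v \<in> e" using t(1) by (auto simp: edges_def)
  then have "\<exists>!e. e \<in> edges T \<and> v \<in> e" using unique by blast
  then have "edge_at T v \<in> edges T \<and> v \<in> edge_at T v" unfolding edge_at_def by (rule theI')
  then show "edge_at T v \<in> edges T" "v \<in> edge_at T v"
    "\<And>e. e \<in> edges T \<Longrightarrow> v \<in> e \<Longrightarrow> e = edge_at T v"
    using unique by auto
qed

lemma edge_at_obtain:
  assumes v: "v \<in> edge_midpoints P"
  obtains a b y where "a \<in> lattice" "b \<in> lattice" "y \<in> lattice" "cross (b - a) y = 1"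
    "edge_at T v = closed_segment a b" "v = midpoint a b"
proof -
  have v': "v \<notin> lattice" "2 *\<^sub>R v \<in> lattice"
    using v by (auto simp: edge_midpoints_def)
  note e = edge_at_props[OF v]
  obtain t where t: "t \<in> T" "edge_at T v edge_of t" using e(1) by (auto simp: edges_def)
  obtain a b c where abc: "a \<in> lattice" "b \<in> lattice" "c \<in> lattice" "orient a b c = 1"
    "t = convex hull {a, b, c}" "edge_at T v = closed_segment a b"
    using triangle_with_side_obtain[OF unimodular t] by metis
  have "v \<in> t" using t(2) e(2) edge_of_imp_subset by blast
  then have "v \<in> {a, b, c, midpoint a b, midpoint b c, midpoint c a}"
    using half_lattice_point_of_unimodular_triangle[OF abc(1-4)] abc(5) v'(2) by simp
  then have "v \<in> {midpoint a b, midpoint b c, midpoint c a}" using abc v' by auto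
  moreover have "orient a b v = 0" using e(2) abc(6) orient_on_closed_segment by blast
  moreover have "orient a b (midpoint b c) = 1 / 2" "orient a b (midpoint c a) = 1 / 2"
    using orient_combination(3)[of 0 "1/2" "1/2" a b c] orient_combination(3)[of "1/2" 0 "1/2" a b c] abc(4)
    by (simp_all add: midpoint_def scaleR_add_right add.commute)
  ultimately have "v = midpoint a b" by auto
  then show thesis using that[of a b "c - a"] abc by (auto simp: orient_def lattice_diff)
qed

lemma edge_at_interior:
  assumes v: "v \<in> edge_midpoints P" and e: "edge_at T v = closed_segment a b" "v = midpoint a b"
  shows "rel_interior (edge_at T v) = open_segment a b" "open_segment a b \<subseteq> interior P"
proof -
  have "v \<in> interior P" using v by (simp add: edge_midpoints_def)
  moreover have ab: "a \<noteq> b"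
    using edge_obtain[OF unimodular edge_at_props(1)[OF v]] e
    by (metis closed_segment_eq_sing closed_segment_idem)
  moreover have "v \<in> open_segment a b" using ab e(2) by (simp add: midpoint_in_open_segment)
  ultimately show *: "rel_interior (edge_at T v) = open_segment a b"
    by (simp add: e(1) rel_interior_closed_segment)
  show "open_segment a b \<subseteq> interior P"
    using rel_interior_edge_cases[OF unimodular edge_at_props(1)[OF v]]
      \<open>v \<in> open_segment a b\<close> \<open>v \<in> interior P\<close> edge_at_props(2)[OF v]
    unfolding * by (auto simp: frontier_def)
qed

lemma edge_at_inj: "inj_on (edge_at T) (edge_midpoints P)"
proof (rule inj_onI)
  fix v w assume v: "v \<in> edge_midpoints P" and w: "w \<in> edge_midpoints P"
    and eq: "edge_at T v = edge_at T w"
  obtain a b where ab: "edge_at T v = closed_segment a b" "v = midpoint a b"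
    using edge_at_obtain[OF v] by metis
  obtain c d where cd: "edge_at T w = closed_segment c d" "w = midpoint c d"
    using edge_at_obtain[OF w] by metis
  have "{a, b} = {c, d}" using eq ab cd by simp
  then show "v = w" unfolding ab cd doubleton_eq_iff by (auto simp: midpoint_sym)
qed

lemma edge_at_inner:
  assumes v: "v \<in> edge_midpoints P"
  shows "edge_at T v \<in> inner_edges P T"
  using edge_at_props(1,2)[OF v] v
  by (auto simp: inner_edges_def edge_midpoints_def frontier_def)

lemma finite_edges: "finite (edges T)"
proof -
  have "edges T \<subseteq> (\<Union>t\<in>T. {e. e face_of t})" by (auto simp: edges_def edge_of_def)
  moreover have "finite {e. e face_of t}" if t: "t \<in> T" for t
  proof -
    obtain a b c where "t = convex hull {a, b, c}"
      using unimodular_triangle_obtain[OF unimodular t] by metis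
    then have "polytope t" by (simp add: polytope_convex_hull)
    then show ?thesis by (rule finite_polytope_faces)
  qed
  ultimately show ?thesis using finite_triangles[OF unimodular] by (meson finite_UN_I finite_subset)
qed

lemma card_edge_midpoints_le: "card (edge_midpoints P) \<le> card (inner_edges P T)"
proof (rule card_inj_on_le[OF edge_at_inj])
  show "edge_at T ` edge_midpoints P \<subseteq> inner_edges P T" using edge_at_inner by auto
  show "finite (inner_edges P T)" using finite_edges by (simp add: inner_edges_def)
qed

lemma edge_with_interior_point:
  assumes e: "e \<in> edges T" and x: "x \<in> e" "x \<in> interior P"
  shows "\<exists>v\<in>edge_midpoints P. e = edge_at T v"
proof -
  obtain a b c where ab: "a \<in> lattice" "b \<in> lattice" "c \<in> lattice" "orient a b c = 1" "e = closed_segment a b"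
    "rel_interior e = open_segment a b" "a \<noteq> b" "e \<subseteq> P"
    using edge_obtain[OF unimodular e] by metis
  let ?v = "midpoint a b"
  have v: "?v \<in> open_segment a b" using ab(7) by (simp add: midpoint_in_open_segment)
  have "?v \<in> interior P"
    using rel_interior_edge_cases[OF unimodular e] x v ab(6) by (auto simp: frontier_def)
  moreover have "?v \<notin> lattice"
  proof
    assume "?v \<in> lattice"
    then have "cross (?v - a) (c - a) \<in> \<int>" using ab by (intro cross_Ints lattice_diff)
    moreover have "?v - a = (1/2) *\<^sub>R (b - a)" by (simp add: midpoint_def prod_eq_iff field_simps)
    ultimately have "(1/2 :: real) \<in> \<int>" using ab(4) by (simp add: orient_def)
    then show False by (simp add: half_not_Ints)
  qed
  moreover have "2 *\<^sub>R ?v \<in> lattice" using ab by (simp add: midpoint_def lattice_add)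
  ultimately have "?v \<in> edge_midpoints P" by (simp add: edge_midpoints_def)
  moreover have "?v \<in> e" using v ab(5) by (auto simp: open_segment_def)
  ultimately show ?thesis using edge_at_props(3) e by blast
qed

end

text \<open>The interior of a triangle \<open>t\<close> of \<open>T\<close> lies in the interior of the region, so an edge of \<open>T'\<close> that meets
  it is an inner edge, hence an edge of \<open>T\<close>, which is absurd. Being connected, the interior of \<open>t\<close> then
  stays in one triangle of \<open>T'\<close>. A unimodular triangle contains no smaller one, because its only lattice
  points are its vertices.\<close>

lemma triangulation_subset_if_same_inner_edges:
  assumes T: "unimodular_triangulation P T" and T': "unimodular_triangulation P T'"
    and eq: "\<And>v. v \<in> edge_midpoints P \<Longrightarrow> edge_at T v = edge_at T' v"
  shows "T \<subseteq> T'"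
proof
  fix t assume t: "t \<in> T"
  note tp = triangle_props[OF T t]
  obtain p where p: "p \<in> interior t" using tp(5) by blast
  then have "p \<in> P" using tp(1) interior_subset by blast
  then obtain t' where t': "t' \<in> T'" "p \<in> t'" using Union_triangles[OF T'] by blast
  note tp' = triangle_props[OF T' t'(1)]
  have "interior t \<inter> frontier t' = {}"
  proof (rule ccontr)
    assume "interior t \<inter> frontier t' \<noteq> {}"
    then obtain x where x: "x \<in> interior t" "x \<in> t'" "x \<notin> interior t'"
      using tp'(3) by (auto simp: frontier_def)
    then obtain e where e: "e edge_of t'" "x \<in> e" using mem_interior_or_edge[OF T' t'(1)] by blast
    then have "e \<in> edges T'" using t' by (auto simp: edges_def)
    moreover have "x \<in> interior P" using x(1) tp(1) interior_mono by blast
    ultimately obtain v where v: "v \<in> edge_midpoints P" "e = edge_at T' v"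
      using edge_with_interior_point[OF T'] e(2) by blast
    then have "e \<in> edges T" using edge_at_props(1)[OF T v(1)] eq by simp
    then show False using edge_avoids_triangle_interior[OF T t] e x by blast
  qed
  then have "interior t \<subseteq> t'"
    using connected_Int_frontier[of "interior t" t'] p t'(2) tp(2)
    by (auto simp: convex_connected convex_interior)
  then have "closure (interior t) \<subseteq> t'" using tp'(3) by (rule closure_minimal)
  then have sub: "t \<subseteq> t'" using convex_closure_interior[OF tp(2,5)] tp(3) by simp
  obtain a b c where abc: "a \<in> lattice" "b \<in> lattice" "c \<in> lattice" "orient a b c = 1"
    "t = convex hull {a, b, c}"
    using unimodular_triangle_obtain[OF T t] by metis
  obtain a' b' c' where abc': "a' \<in> lattice" "b' \<in> lattice" "c' \<in> lattice" "orient a' b' c' = 1"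
    "t' = convex hull {a', b', c'}"
    using unimodular_triangle_obtain[OF T' t'(1)] by metis
  have "{a, b, c} \<subseteq> t'" using sub abc(5) hull_subset by (metis subset_trans)
  then have "{a, b, c} \<subseteq> {a', b', c'}"
    using lattice_point_of_unimodular_triangle[OF abc'(1-4)] abc abc'(5) by blast
  moreover have "card {a, b, c} = 3" "card {a', b', c'} = 3"
    using orient_nonzero_affine_independent[of a b c] orient_nonzero_affine_independent[of a' b' c'] abc abc'
    by auto
  ultimately have "{a, b, c} = {a', b', c'}" by (intro card_subset_eq) auto
  then show "t \<in> T'" using abc abc' t'(1) by simp
qed

lemma triangulation_eq_if_same_inner_edges:
  assumes "unimodular_triangulation P T" "unimodular_triangulation P T'"
    and "\<And>v. v \<in> edge_midpoints P \<Longrightarrow> edge_at T v = edge_at T' v"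
  shows "T = T'"
  using triangulation_subset_if_same_inner_edges[of P T T'] triangulation_subset_if_same_inner_edges[of P T' T]
    assms by auto

lemma open_edge_no_lattice_points:
  assumes T: "unimodular_triangulation P T" and v: "v \<in> edge_midpoints P"
    and e: "edge_at T v = closed_segment a b" "v = midpoint a b"
  shows "open_segment a b \<inter> lattice = {}"
proof -
  obtain t where t: "t \<in> T" "edge_at T v edge_of t"
    using edge_at_props(1)[OF T v] by (auto simp: edges_def)
  obtain a' b' c' where abc: "a' \<in> lattice" "b' \<in> lattice" "c' \<in> lattice" "orient a' b' c' = 1"
    "t = convex hull {a', b', c'}" "edge_at T v = closed_segment a' b'"
    using triangle_with_side_obtain[OF T t] by metis
  have ab: "{a, b} = {a', b'}" using e abc(6) by (metis closed_segment_eq)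
  have "x \<in> {a', b'}" if x: "x \<in> closed_segment a' b'" "x \<in> lattice" for x
  proof -
    have "x \<in> t" using x(1) t(2) abc(6) edge_of_imp_subset by blast
    then have "x \<in> {a', b', c'}"
      using lattice_point_of_unimodular_triangle[OF abc(1-4)] abc(5) x(2) by simp
    moreover have "orient a' b' x = 0" using x(1) by (rule orient_on_closed_segment)
    ultimately show ?thesis using abc(4) by auto
  qed
  then have "closed_segment a' b' \<inter> lattice \<subseteq> {a', b'}" by blast
  moreover have seg: "closed_segment a b = closed_segment a' b'"
    using e(1) abc(6) by (rule trans[OF sym])
  ultimately show ?thesis unfolding open_segment_def seg ab by blast
qed

section \<open>Two edges with a common midpoint\<close>

lemma cross_affine:
  "cross d ((1 - s) *\<^sub>R p + s *\<^sub>R q - v) = (1 - s) * cross d (p - v) + s * cross d (q - v)"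
  by (simp add: cross_def algebra_simps)

text \<open>The functions \<open>H\<close> and \<open>K\<close> are affine coordinates centred at \<open>v\<close>, in which the segments with
  midpoint \<open>v\<close> and directions \<open>d\<^sub>1\<close>, \<open>d\<^sub>2\<close> become the pieces \<open>\<bar>K\<bar> \<le> D/2\<close> and \<open>\<bar>H\<bar> \<le> D/2\<close> of the axes
  \<open>H = 0\<close> and \<open>K = 0\<close>. A segment from \<open>H \<le> 0\<close> to \<open>H \<ge> 1\<close> that passes \<open>H = 1/2\<close> close to the axis \<open>K = 0\<close>
  either meets the axis \<open>H = 0\<close> in the first piece, or it starts far out on one side; since \<open>K\<close> is nearly
  \<open>0\<close> halfway, it then ends on the other side and has crossed the second piece.\<close>

lemma segment_in_strip_crosses_axes:
  fixes p q u v d\<^sub>1 d\<^sub>2 :: plane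
  defines "H x \<equiv> cross d\<^sub>1 (x - v)" and "K x \<equiv> cross d\<^sub>2 (x - v)"
  assumes D: "D = cross d\<^sub>1 d\<^sub>2" "D > 2"
    and H: "H p \<le> 0" "1 \<le> H q" and u: "u \<in> closed_segment p q" "H u = 1 / 2" "\<bar>K u\<bar> < D / 4"
  shows "\<exists>y\<in>closed_segment p q. H y = 0 \<and> \<bar>K y\<bar> < D / 2 \<or> K y = 0 \<and> \<bar>H y\<bar> < D / 2"
proof -
  obtain s where s: "0 \<le> s" "s \<le> 1" "u = (1 - s) *\<^sub>R p + s *\<^sub>R q" using u(1) by (auto simp: in_segment)
  have aff: "H ((1 - r) *\<^sub>R x + r *\<^sub>R y) = (1 - r) * H x + r * H y"
    "K ((1 - r) *\<^sub>R x + r *\<^sub>R y) = (1 - r) * K x + r * K y" for r x y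
    unfolding H_def K_def by (rule cross_affine)+
  define e where "e = H q - H p"
  have e: "e \<ge> 1" using H by (simp add: e_def)
  have se: "s * e = 1/2 - H p" using u(2) unfolding s(3) aff by (simp add: e_def algebra_simps)
  then have seq: "s = (1/2 - H p) / e" using e by (simp add: field_simps)
  \<comment> \<open>The points of the segment with \<open>H = 0\<close> and \<open>H = 1\<close>; their midpoint is \<open>u\<close>.\<close>
  define r\<^sub>0 r\<^sub>1 where "r\<^sub>0 = s - 1 / (2 * e)" and "r\<^sub>1 = s + 1 / (2 * e)"
  have r0: "r\<^sub>0 = (- H p) / e" and r1: "r\<^sub>1 = (1 - H p) / e"
    using e unfolding r\<^sub>0_def r\<^sub>1_def seq by (simp_all add: field_simps)
  have r01: "0 \<le> r\<^sub>0" "r\<^sub>0 \<le> 1" "0 \<le> r\<^sub>1" "r\<^sub>1 \<le> 1"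
    using H e unfolding r0 r1 by (simp_all add: divide_simps) (simp_all add: e_def)
  define y\<^sub>0 y\<^sub>1 where "y\<^sub>0 = (1 - r\<^sub>0) *\<^sub>R p + r\<^sub>0 *\<^sub>R q" and "y\<^sub>1 = (1 - r\<^sub>1) *\<^sub>R p + r\<^sub>1 *\<^sub>R q"
  have mem: "y\<^sub>0 \<in> closed_segment p q" "y\<^sub>1 \<in> closed_segment p q"
    using r01 unfolding y\<^sub>0_def y\<^sub>1_def in_segment by blast+
  have Haff: "H ((1 - r) *\<^sub>R p + r *\<^sub>R q) = H p + r * e" for r
    unfolding aff by (simp add: e_def algebra_simps)
  have Hy: "H y\<^sub>0 = 0" "H y\<^sub>1 = 1"
    using e unfolding y\<^sub>0_def y\<^sub>1_def Haff r0 r1 by simp_all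
  have "r\<^sub>0 + r\<^sub>1 = 2 * s" by (simp add: r\<^sub>0_def r\<^sub>1_def)
  then have r1': "r\<^sub>1 = 2 * s - r\<^sub>0" by simp
  have Ky: "K y\<^sub>0 + K y\<^sub>1 = 2 * K u"
    unfolding y\<^sub>0_def y\<^sub>1_def s(3) aff r1' by (simp add: algebra_simps)
  show ?thesis
  proof (cases "\<bar>K y\<^sub>0\<bar> < D / 2")
    case True
    then show ?thesis using mem(1) Hy(1) by blast
  next
    case False
    then have opp: "K y\<^sub>0 > 0 \<and> K y\<^sub>1 < 0 \<or> K y\<^sub>0 < 0 \<and> K y\<^sub>1 > 0"
      using Ky u(3) D(2) by linarith
    define r where "r = K y\<^sub>0 / (K y\<^sub>0 - K y\<^sub>1)"
    have r: "0 < r" "r < 1" using opp by (auto simp: r_def divide_simps)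
    define y where "y = (1 - r) *\<^sub>R y\<^sub>0 + r *\<^sub>R y\<^sub>1"
    have "y \<in> closed_segment y\<^sub>0 y\<^sub>1" using r unfolding y_def in_segment by (intro conjI exI[of _ r]) auto
    then have "y \<in> closed_segment p q" using mem by (meson closed_segment_subset convex_closed_segment subsetD)
    moreover have "K y = 0" unfolding y_def aff using opp by (auto simp: r_def divide_simps)
    moreover have "H y = r" unfolding y_def aff Hy by simp
    ultimately show ?thesis using r D(2) by (intro bexI[of _ y]) auto
  qed
qed

lemma cross_coordinates:
  assumes "D = cross d\<^sub>1 d\<^sub>2" "D \<noteq> 0"
  shows "y = v - (cross d\<^sub>2 (y - v) / D) *\<^sub>R d\<^sub>1 + (cross d\<^sub>1 (y - v) / D) *\<^sub>R d\<^sub>2"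
proof -
  have "D *\<^sub>R (y - v) = cross d\<^sub>1 (y - v) *\<^sub>R d\<^sub>2 - cross d\<^sub>2 (y - v) *\<^sub>R d\<^sub>1"
    unfolding assms(1) by (simp add: cross_def prod_eq_iff algebra_simps)
  then have "(1 / D) *\<^sub>R (D *\<^sub>R (y - v)) = (cross d\<^sub>1 (y - v) / D) *\<^sub>R d\<^sub>2 - (cross d\<^sub>2 (y - v) / D) *\<^sub>R d\<^sub>1"
    by (simp add: scaleR_diff_right)
  then have "y - v = (cross d\<^sub>1 (y - v) / D) *\<^sub>R d\<^sub>2 - (cross d\<^sub>2 (y - v) / D) *\<^sub>R d\<^sub>1"
    using assms(2) by simp
  then show ?thesis by (simp add: algebra_simps)
qed

lemma mem_open_segment_around_midpoint:
  assumes "v = midpoint a b" "a \<noteq> b" "\<bar>r\<bar> < 1 / 2"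
  shows "v + r *\<^sub>R (b - a) \<in> open_segment a (b::plane)"
proof -
  have "v + r *\<^sub>R (b - a) = (1 - (1/2 + r)) *\<^sub>R a + (1/2 + r) *\<^sub>R b"
    unfolding assms(1) midpoint_def by (simp add: prod_eq_iff field_simps)
  then show ?thesis using assms by (auto simp: in_segment abs_less_iff intro!: exI[of _ "1/2 + r"])
qed

text \<open>In the coordinates \<open>H\<close> and \<open>K\<close> of \<open>segment_in_strip_crosses_axes\<close>, with \<open>d\<^sub>i = b\<^sub>i - a\<^sub>i\<close>, the two segments at \<open>v\<close> are the
  two pieces of the axes. The coordinate \<open>H\<close> is integral at lattice points, so a lattice segment through a point with
  \<open>H = 1/2\<close> has one end with \<open>H \<le> 0\<close> and the other with \<open>H \<ge> 1\<close>.\<close>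

lemma lattice_segment_crosses:
  assumes lat: "a\<^sub>1 \<in> lattice" "b\<^sub>1 \<in> lattice" and v: "v = midpoint a\<^sub>1 b\<^sub>1" "v = midpoint a\<^sub>2 b\<^sub>2"
    and D: "D = cross (b\<^sub>1 - a\<^sub>1) (b\<^sub>2 - a\<^sub>2)" "D > 2"
    and pq: "p \<in> lattice" "q \<in> lattice" "u \<in> closed_segment p q"
    and u: "cross (b\<^sub>1 - a\<^sub>1) (u - v) = 1 / 2" "\<bar>cross (b\<^sub>2 - a\<^sub>2) (u - v)\<bar> < D / 4"
  shows "\<exists>y\<in>closed_segment p q. y \<in> open_segment a\<^sub>1 b\<^sub>1 \<or> y \<in> open_segment a\<^sub>2 b\<^sub>2"
proof -
  let ?d1 = "b\<^sub>1 - a\<^sub>1" and ?d2 = "b\<^sub>2 - a\<^sub>2"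
  have ne: "a\<^sub>1 \<noteq> b\<^sub>1" "a\<^sub>2 \<noteq> b\<^sub>2" using D by (auto simp: cross_def)
  have int: "cross ?d1 (x - v) \<in> \<int>" if "x \<in> lattice" for x
  proof -
    have "cross ?d1 (x - v) = cross ?d1 (x - a\<^sub>1)"
      unfolding v(1) midpoint_def by (simp add: cross_def field_simps)
    then show ?thesis using that lat by (auto intro!: cross_Ints lattice_diff)
  qed
  obtain s where s: "0 \<le> s" "s \<le> 1" "u = (1 - s) *\<^sub>R p + s *\<^sub>R q"
    using pq(3) by (auto simp: in_segment)
  have sum: "(1 - s) * cross ?d1 (p - v) + s * cross ?d1 (q - v) = 1/2"
    using u(1) unfolding s(3) cross_affine .
  obtain i j where ij: "cross ?d1 (p - v) = of_int i" "cross ?d1 (q - v) = of_int j"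
    using int[OF pq(1)] int[OF pq(2)] by (metis Ints_cases)
  have "i \<le> 0 \<and> 1 \<le> j \<or> j \<le> 0 \<and> 1 \<le> i"
  proof (rule ccontr)
    assume "\<not> ?thesis"
    then consider "i \<le> 0" "j \<le> 0" | "1 \<le> i" "1 \<le> j" by linarith
    then show False
    proof cases
      case 1
      then have "(1 - s) * of_int i \<le> 0" "s * of_int j \<le> 0"
        using s by (auto simp: mult_nonneg_nonpos)
      then show False using sum ij by simp
    next
      case 2
      then have "(1 - s) * 1 \<le> (1 - s) * of_int i" "s * 1 \<le> s * of_int j"
        using s by (intro mult_left_mono; simp)+
      then show False using sum ij by simp
    qed
  qed
  then have "(cross ?d1 (p - v) \<le> 0 \<and> 1 \<le> cross ?d1 (q - v)) \<or>
    (cross ?d1 (q - v) \<le> 0 \<and> 1 \<le> cross ?d1 (p - v))"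
    unfolding ij by auto
  then have "\<exists>y\<in>closed_segment p q. cross ?d1 (y - v) = 0 \<and> \<bar>cross ?d2 (y - v)\<bar> < D / 2 \<or>
      cross ?d2 (y - v) = 0 \<and> \<bar>cross ?d1 (y - v)\<bar> < D / 2"
  proof (elim disjE conjE)
    assume "cross ?d1 (p - v) \<le> 0" "1 \<le> cross ?d1 (q - v)"
    then show ?thesis by (rule segment_in_strip_crosses_axes[OF D _ _ pq(3) u])
  next
    assume *: "cross ?d1 (q - v) \<le> 0" "1 \<le> cross ?d1 (p - v)"
    have "u \<in> closed_segment q p" using pq(3) by (simp add: closed_segment_commute)
    from segment_in_strip_crosses_axes[OF D * this u] show ?thesis
      by (simp only: closed_segment_commute[of q p])
  qed
  then obtain y where y: "y \<in> closed_segment p q" and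
    cases: "cross ?d1 (y - v) = 0 \<and> \<bar>cross ?d2 (y - v)\<bar> < D / 2 \<or>
      cross ?d2 (y - v) = 0 \<and> \<bar>cross ?d1 (y - v)\<bar> < D / 2"
    by blast
  have "D \<noteq> 0" using D(2) by simp
  note coords = cross_coordinates[OF D(1) this, of y v]
  have small: "\<bar>- (r / D)\<bar> < 1/2" "\<bar>r / D\<bar> < 1/2" if "\<bar>r\<bar> < D / 2" for r
    using that D(2) by (simp_all add: abs_less_iff divide_simps)
  from cases have "y \<in> open_segment a\<^sub>1 b\<^sub>1 \<or> y \<in> open_segment a\<^sub>2 b\<^sub>2"
  proof (elim disjE conjE)
    assume *: "cross ?d1 (y - v) = 0" "\<bar>cross ?d2 (y - v)\<bar> < D / 2"
    have "y = v + (- (cross ?d2 (y - v) / D)) *\<^sub>R ?d1" using coords *(1) by simp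
    then show ?thesis
      using mem_open_segment_around_midpoint[OF v(1) ne(1) small(1)[OF *(2)]] by simp
  next
    assume *: "cross ?d2 (y - v) = 0" "\<bar>cross ?d1 (y - v)\<bar> < D / 2"
    have "y = v + (cross ?d1 (y - v) / D) *\<^sub>R ?d2" using coords *(1) by simp
    then show ?thesis
      using mem_open_segment_around_midpoint[OF v(2) ne(2) small(2)[OF *(2)]] by simp
  qed
  then show ?thesis using y by blast
qed

text \<open>No edge through \<open>m\<close> can be shared by both triangulations, since it would cross one of the two
  edges at \<open>v\<close>. The same crossing argument keeps the frontier of the region away from the
  segment on \<open>H = 1/2\<close> between the second edge and \<open>m\<close>, so that \<open>m\<close> lies in the interior of the region.\<close>

lemma obstructing_midpoint:
  assumes T1: "unimodular_triangulation P T\<^sub>1" and T2: "unimodular_triangulation P T\<^sub>2"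
    and vM: "v \<in> edge_midpoints P"
    and e1: "edge_at T\<^sub>1 v = closed_segment a\<^sub>1 b\<^sub>1" "a\<^sub>1 \<in> lattice" "b\<^sub>1 \<in> lattice" "v = midpoint a\<^sub>1 b\<^sub>1"
    and e2: "edge_at T\<^sub>2 v = closed_segment a\<^sub>2 b\<^sub>2" "a\<^sub>2 \<in> lattice" "b\<^sub>2 \<in> lattice" "v = midpoint a\<^sub>2 b\<^sub>2"
    and D: "D = cross (b\<^sub>1 - a\<^sub>1) (b\<^sub>2 - a\<^sub>2)" "D > 2"
    and m: "2 *\<^sub>R m \<in> lattice" "cross (b\<^sub>1 - a\<^sub>1) (m - v) = 1 / 2" "\<bar>cross (b\<^sub>2 - a\<^sub>2) (m - v)\<bar> < D / 4"
  shows "m \<in> edge_midpoints P" "edge_at T\<^sub>1 m \<noteq> edge_at T\<^sub>2 m"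
proof -
  let ?d1 = "b\<^sub>1 - a\<^sub>1" and ?d2 = "b\<^sub>2 - a\<^sub>2"
  note crosses = lattice_segment_crosses[OF e1(2,3) e1(4) e2(4) D]
  note open1 = edge_at_interior[OF T1 vM e1(1,4)]
  note open2 = edge_at_interior[OF T2 vM e2(1,4)]
  have ne2: "a\<^sub>2 \<noteq> b\<^sub>2" using D by (auto simp: cross_def)
  have not_lattice: "x \<notin> lattice" if "cross ?d1 (x - v) = 1 / 2" for x
  proof
    assume "x \<in> lattice"
    then have "cross ?d1 (x - a\<^sub>1) \<in> \<int>" using e1 by (intro cross_Ints lattice_diff)
    moreover have "cross ?d1 (x - a\<^sub>1) = cross ?d1 (x - v)"
      unfolding e1(4) midpoint_def by (simp add: cross_def field_simps)
    ultimately show False using that half_not_Ints by simp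
  qed
  have no_frontier: "u \<notin> frontier P"
    if u: "cross ?d1 (u - v) = 1 / 2" "\<bar>cross ?d2 (u - v)\<bar> < D / 4" for u
  proof
    assume fr: "u \<in> frontier P"
    then have "u \<in> P" "u \<notin> interior P" using closed_region[OF T1] by (auto simp: frontier_def)
    then obtain t where t: "t \<in> T\<^sub>1" "u \<in> t" using Union_triangles[OF T1] by blast
    have "u \<notin> interior t"
      using triangle_props(1)[OF T1 t(1)] \<open>u \<notin> interior P\<close> interior_mono by blast
    then obtain e where e: "e edge_of t" "u \<in> e" using mem_interior_or_edge[OF T1 t] by blast
    then have eT: "e \<in> edges T\<^sub>1" using t by (auto simp: edges_def)
    obtain p q where pq: "p \<in> lattice" "q \<in> lattice" "e = closed_segment p q"
      "rel_interior e = open_segment p q"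
      using edge_obtain[OF T1 eT] by metis
    have "u \<in> rel_interior e" using e(2) pq not_lattice[OF u(1)] by (auto simp: open_segment_def)
    then have "e \<subseteq> frontier P"
      using rel_interior_edge_cases[OF T1 eT] \<open>u \<notin> interior P\<close> by blast
    moreover obtain y where "y \<in> e" "y \<in> open_segment a\<^sub>1 b\<^sub>1 \<or> y \<in> open_segment a\<^sub>2 b\<^sub>2"
      using crosses[OF pq(1,2) e(2)[unfolded pq(3)] u] pq(3) by blast
    ultimately show False using open1(2) open2(2) by (auto simp: frontier_def)
  qed
  \<comment> \<open>A point of the second edge from which \<open>m\<close> can be reached along \<open>H = 1/2\<close>.\<close>
  define u\<^sub>0 where "u\<^sub>0 = v + (1 / (2 * D)) *\<^sub>R ?d2"
  have u0: "cross ?d1 (u\<^sub>0 - v) = 1 / 2" "cross ?d2 (u\<^sub>0 - v) = 0"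
    using D by (simp_all add: u\<^sub>0_def cross_self)
  have "\<bar>1 / (2 * D)\<bar> < 1 / 2" using D(2) by (simp add: divide_simps)
  then have "u\<^sub>0 \<in> open_segment a\<^sub>2 b\<^sub>2"
    unfolding u\<^sub>0_def by (rule mem_open_segment_around_midpoint[OF e2(4) ne2])
  then have "u\<^sub>0 \<in> P" using open2(2) interior_subset by blast
  have "closed_segment u\<^sub>0 m \<inter> frontier P = {}"
  proof -
    have "x \<notin> frontier P" if x: "x \<in> closed_segment u\<^sub>0 m" for x
    proof -
      obtain s where s: "0 \<le> s" "s \<le> 1" "x = (1 - s) *\<^sub>R u\<^sub>0 + s *\<^sub>R m"
        using x by (auto simp: in_segment)
      have "cross ?d1 (x - v) = 1 / 2"
        unfolding s(3) cross_affine u0 m(2) by (simp add: diff_divide_distrib)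
      moreover have "\<bar>cross ?d2 (x - v)\<bar> < D / 4"
      proof -
        have "\<bar>cross ?d2 (x - v)\<bar> = s * \<bar>cross ?d2 (m - v)\<bar>"
          unfolding s(3) cross_affine u0 using s by (simp add: abs_mult)
        also have "\<dots> \<le> 1 * \<bar>cross ?d2 (m - v)\<bar>" using s by (intro mult_right_mono) auto
        finally show ?thesis using m(3) by simp
      qed
      ultimately show ?thesis by (rule no_frontier)
    qed
    then show ?thesis by blast
  qed
  then have "closed_segment u\<^sub>0 m \<subseteq> P"
    using connected_Int_frontier[of "closed_segment u\<^sub>0 m" P] \<open>u\<^sub>0 \<in> P\<close> by auto
  then have "m \<in> interior P"
    using no_frontier[OF m(2,3)] closed_region[OF T1] by (auto simp: frontier_def)
  then show mM: "m \<in> edge_midpoints P"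
    using m(1) not_lattice[OF m(2)] by (simp add: edge_midpoints_def)
  show "edge_at T\<^sub>1 m \<noteq> edge_at T\<^sub>2 m"
  proof
    assume eq: "edge_at T\<^sub>1 m = edge_at T\<^sub>2 m"
    let ?g = "edge_at T\<^sub>1 m"
    have g: "?g \<in> edges T\<^sub>1" "?g \<in> edges T\<^sub>2" "m \<in> ?g"
      using edge_at_props(1,2)[OF T1 mM] edge_at_props(1)[OF T2 mM] eq by auto
    obtain p q where pq: "p \<in> lattice" "q \<in> lattice" "?g = closed_segment p q"
      using edge_obtain[OF T1 g(1)] by metis
    obtain y where y: "y \<in> ?g" "y \<in> open_segment a\<^sub>1 b\<^sub>1 \<or> y \<in> open_segment a\<^sub>2 b\<^sub>2"
      using crosses[OF pq(1,2) g(3)[unfolded pq(3)] m(2,3)] pq(3) by blast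
    then have "edge_at T\<^sub>1 v = ?g \<or> edge_at T\<^sub>2 v = ?g"
      using edges_noncrossing[OF T1 edge_at_props(1)[OF T1 vM] g(1), of y]
        edges_noncrossing[OF T2 edge_at_props(1)[OF T2 vM] g(2), of y] open1(1) open2(1) by blast
    then have "v = m"
      using edge_at_inj[OF T1] edge_at_inj[OF T2] vM mM eq by (auto dest: inj_onD)
    then show False using m(2) by (simp add: cross_def)
  qed
qed

text \<open>The lattice points on the line \<open>H = 1\<close> have distance \<open>D\<close> in the coordinate \<open>K\<close>, and \<open>K = 0\<close> is not
  among their values: there the line meets the second segment, in its relative interior if \<open>D > 2\<close>. So
  some lattice point \<open>x\<close> on this line has \<open>0 < K x < D\<close>, and halfway between \<open>x\<close> and the end \<open>b\<^sub>1\<close>, where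
  \<open>K = - D/2\<close>, the coordinate \<open>K\<close> is small enough for the crossing argument.\<close>

lemma half_point_beside_edge:
  assumes lat: "a\<^sub>1 \<in> lattice" "b\<^sub>1 \<in> lattice" "a\<^sub>2 \<in> lattice" "b\<^sub>2 \<in> lattice" "y \<in> lattice"
    and v: "v = midpoint a\<^sub>1 b\<^sub>1" "v = midpoint a\<^sub>2 b\<^sub>2"
    and y: "cross (b\<^sub>1 - a\<^sub>1) y = 1"
    and D: "D = cross (b\<^sub>1 - a\<^sub>1) (b\<^sub>2 - a\<^sub>2)" "D > 2"
    and primitive: "open_segment a\<^sub>2 b\<^sub>2 \<inter> lattice = {}"
  obtains m where "2 *\<^sub>R m \<in> lattice" "cross (b\<^sub>1 - a\<^sub>1) (m - v) = 1 / 2"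
    "\<bar>cross (b\<^sub>2 - a\<^sub>2) (m - v)\<bar> < D / 4"
proof -
  let ?d1 = "b\<^sub>1 - a\<^sub>1" and ?d2 = "b\<^sub>2 - a\<^sub>2"
  have ne2: "a\<^sub>2 \<noteq> b\<^sub>2" using D by (auto simp: cross_def)
  have av: "a\<^sub>1 - v = (- 1/2) *\<^sub>R ?d1" "b\<^sub>1 - v = (1/2) *\<^sub>R ?d1"
    unfolding v(1) midpoint_def by (simp_all add: prod_eq_iff field_simps)
  have D': "cross ?d2 ?d1 = - D" using D(1) cross_swap[of ?d2 ?d1] by simp
  \<comment> \<open>Translating by the first edge vector changes \<open>K\<close> by \<open>D\<close>, which brings \<open>K\<close> into \<open>[0, D)\<close>.\<close>
  define c where "c = cross ?d2 (a\<^sub>1 + y - v)"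
  define j where "j = \<lfloor>c / D\<rfloor>"
  define x where "x = a\<^sub>1 + y + of_int j *\<^sub>R ?d1"
  have x: "x \<in> lattice" using lat by (auto simp: x_def intro!: lattice_add lattice_scaleR lattice_diff)
  have xv: "x - v = (- 1/2) *\<^sub>R ?d1 + y + of_int j *\<^sub>R ?d1" using av(1) by (simp add: x_def algebra_simps)
  have Hx: "cross ?d1 (x - v) = 1" unfolding xv by (simp add: cross_add cross_self y del: scaleR_minus_left)
  have "x - v = (a\<^sub>1 + y - v) + of_int j *\<^sub>R ?d1" by (simp add: x_def algebra_simps)
  then have Kx: "cross ?d2 (x - v) = c - of_int j * D" by (simp only: cross_add cross_scaleR c_def D')
  have "of_int j \<le> c / D" "c / D < of_int j + 1" unfolding j_def by linarith+
  then have K: "0 \<le> cross ?d2 (x - v)" "cross ?d2 (x - v) < D"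
    unfolding Kx using D(2) by (simp_all add: field_simps)
  have "cross ?d2 (x - v) \<noteq> 0"
  proof
    assume 0: "cross ?d2 (x - v) = 0"
    have "D \<noteq> 0" using D(2) by simp
    from cross_coordinates[OF D(1) this, of x v] have "x = v + (1 / D) *\<^sub>R ?d2" using 0 Hx by simp
    moreover have "\<bar>1 / D\<bar> < 1/2" using D(2) by (simp add: divide_simps)
    ultimately have "x \<in> open_segment a\<^sub>2 b\<^sub>2"
      using mem_open_segment_around_midpoint[OF v(2) ne2] by metis
    then show False using x primitive by blast
  qed
  then have Kpos: "0 < cross ?d2 (x - v)" using K by simp
  define m where "m = midpoint x b\<^sub>1"
  have mv: "m - v = (1/2) *\<^sub>R (x - v) + (1/4) *\<^sub>R ?d1"
  proof -
    have "m - v = (1/2) *\<^sub>R (x - v) + (1/2) *\<^sub>R (b\<^sub>1 - v)"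
      by (simp add: m_def midpoint_def prod_eq_iff field_simps)
    then show ?thesis unfolding av(2) by simp
  qed
  show thesis
  proof (rule that)
    show "2 *\<^sub>R m \<in> lattice" using x lat by (simp add: m_def midpoint_def lattice_add)
    show "cross ?d1 (m - v) = 1 / 2" unfolding mv by (simp add: cross_add cross_self Hx)
    have "cross ?d2 (m - v) = cross ?d2 (x - v) / 2 - D / 4"
      unfolding mv by (simp add: cross_add D')
    then show "\<bar>cross ?d2 (m - v)\<bar> < D / 4" using Kpos K(2) by linarith
  qed
qed

section \<open>At most two choices for the next edge\<close>

text \<open>A linear functional with irrational slope orders the half-integral points without ties, and of any
  two points that are symmetric about \<open>v\<close> it puts one before \<open>v\<close>.\<close>

definition sweep :: "real \<Rightarrow> plane \<Rightarrow> real" where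
  "sweep \<kappa> p = fst p + \<kappa> * snd p"

lemma sweep_inj:
  assumes "\<kappa> \<notin> \<rat>"
  shows "inj_on (sweep \<kappa>) (edge_midpoints P)"
proof (rule inj_onI)
  fix v w assume v: "v \<in> edge_midpoints P" and w: "w \<in> edge_midpoints P" and eq: "sweep \<kappa> v = sweep \<kappa> w"
  have "2 *\<^sub>R v - 2 *\<^sub>R w \<in> lattice"
    using v w by (auto simp: edge_midpoints_def intro: lattice_diff)
  then have Q: "2 * (fst v - fst w) \<in> \<rat>" "2 * (snd v - snd w) \<in> \<rat>"
    by (auto simp: lattice_iff algebra_simps intro: Ints_subset_Rats[THEN subsetD])
  have e: "2 * (fst w - fst v) = \<kappa> * (2 * (snd v - snd w))"
    using eq by (simp add: sweep_def algebra_simps)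
  have "snd v = snd w"
  proof (rule ccontr)
    assume "snd v \<noteq> snd w"
    then have "\<kappa> = - (2 * (fst v - fst w)) / (2 * (snd v - snd w))" using e by (simp add: field_simps)
    moreover have "- (2 * (fst v - fst w)) / (2 * (snd v - snd w)) \<in> \<rat>"
      using Q by (intro Rats_divide Rats_minus_iff[THEN iffD2])
    ultimately show False using assms by simp
  qed
  then show "v = w" using e by (simp add: prod_eq_iff)
qed

text \<open>Primitive lattice vectors that are parallel agree up to sign.\<close>

lemma cross_edges_nonzero:
  assumes lat: "a\<^sub>1 \<in> lattice" "b\<^sub>1 \<in> lattice" "a\<^sub>2 \<in> lattice" "b\<^sub>2 \<in> lattice" "y\<^sub>1 \<in> lattice" "y\<^sub>2 \<in> lattice"
    and v: "midpoint a\<^sub>1 b\<^sub>1 = midpoint a\<^sub>2 b\<^sub>2"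
    and y: "cross (b\<^sub>1 - a\<^sub>1) y\<^sub>1 = 1" "cross (b\<^sub>2 - a\<^sub>2) y\<^sub>2 = 1"
    and ne: "closed_segment a\<^sub>1 b\<^sub>1 \<noteq> closed_segment a\<^sub>2 b\<^sub>2"
  shows "cross (b\<^sub>1 - a\<^sub>1) (b\<^sub>2 - a\<^sub>2) \<noteq> 0"
proof
  let ?d1 = "b\<^sub>1 - a\<^sub>1" and ?d2 = "b\<^sub>2 - a\<^sub>2"
  assume 0: "cross ?d1 ?d2 = 0"
  have id: "cross p y *\<^sub>R q = cross q y *\<^sub>R p + cross p q *\<^sub>R y" for p q y
    by (simp add: cross_def prod_eq_iff algebra_simps)
  obtain i j where ij: "cross ?d2 y\<^sub>1 = of_int i" "cross ?d1 y\<^sub>2 = of_int j"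
    using lat by (metis Ints_cases cross_Ints lattice_diff)
  have 1: "?d2 = of_int i *\<^sub>R ?d1" using id[of ?d1 y\<^sub>1 ?d2] 0 y(1) ij by simp
  have 2: "?d1 = of_int j *\<^sub>R ?d2" using id[of ?d2 y\<^sub>2 ?d1] 0 y(2) ij cross_swap[of ?d2 ?d1] by simp
  have "1 = cross (of_int j *\<^sub>R ?d2) y\<^sub>1" using y(1) 2 by simp
  also have "\<dots> = of_int (j * i)" using ij by simp
  finally have "real_of_int (j * i) = 1" by simp
  then have "j * i = 1" by linarith
  then have "i = 1 \<or> i = - 1" by (auto simp: zmult_eq_1_iff)
  then have "b\<^sub>2 - a\<^sub>2 = b\<^sub>1 - a\<^sub>1 \<or> b\<^sub>2 - a\<^sub>2 = a\<^sub>1 - b\<^sub>1" using 1 by auto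
  moreover have "a\<^sub>1 + b\<^sub>1 = a\<^sub>2 + b\<^sub>2" using v by (simp add: midpoint_def)
  ultimately have "a\<^sub>1 = a\<^sub>2 \<and> b\<^sub>1 = b\<^sub>2 \<or> a\<^sub>1 = b\<^sub>2 \<and> b\<^sub>1 = a\<^sub>2"
    by (auto simp: prod_eq_iff)
  then show False using ne by (auto simp: closed_segment_commute)
qed

text \<open>The determinant is even, because both edge vectors are congruent to \<open>2v\<close> modulo twice the lattice. If
  it were at least 4, the obstructing midpoint \<open>m\<close> and its mirror image \<open>2v - m\<close>, which is the obstructing
  midpoint for the reversed edges, would both carry different edges in the two triangulations. But one of
  them comes before \<open>v\<close>.\<close>

lemma first_difference_pos:
  assumes T1: "unimodular_triangulation P T\<^sub>1" and T2: "unimodular_triangulation P T\<^sub>2"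
    and irr: "\<kappa> \<notin> \<rat>" and vM: "v \<in> edge_midpoints P"
    and agree: "\<And>u. u \<in> edge_midpoints P \<Longrightarrow> sweep \<kappa> u < sweep \<kappa> v \<Longrightarrow> edge_at T\<^sub>1 u = edge_at T\<^sub>2 u"
    and e1: "edge_at T\<^sub>1 v = closed_segment a\<^sub>1 b\<^sub>1" "a\<^sub>1 \<in> lattice" "b\<^sub>1 \<in> lattice" "v = midpoint a\<^sub>1 b\<^sub>1"
    and e2: "edge_at T\<^sub>2 v = closed_segment a\<^sub>2 b\<^sub>2" "a\<^sub>2 \<in> lattice" "b\<^sub>2 \<in> lattice" "v = midpoint a\<^sub>2 b\<^sub>2"
    and y: "y \<in> lattice" "cross (b\<^sub>1 - a\<^sub>1) y = 1"
    and pos: "cross (b\<^sub>1 - a\<^sub>1) (b\<^sub>2 - a\<^sub>2) > 0"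
  shows "cross (b\<^sub>1 - a\<^sub>1) (b\<^sub>2 - a\<^sub>2) = 2"
proof (rule ccontr)
  let ?d1 = "b\<^sub>1 - a\<^sub>1" and ?d2 = "b\<^sub>2 - a\<^sub>2"
  define D where "D = cross ?d1 ?d2"
  assume "cross ?d1 ?d2 \<noteq> 2"
  have sum: "a\<^sub>1 + b\<^sub>1 = a\<^sub>2 + b\<^sub>2" using e1(4) e2(4) by (simp add: midpoint_def)
  then have "?d2 = 2 *\<^sub>R (b\<^sub>2 - a\<^sub>1) - ?d1" by (auto simp: prod_eq_iff algebra_simps)
  then have "D = 2 * cross ?d1 (b\<^sub>2 - a\<^sub>1)" unfolding D_def by (simp only: cross_diff cross_scaleR cross_self)
  moreover have "cross ?d1 (b\<^sub>2 - a\<^sub>1) \<in> \<int>" using e1 e2 by (intro cross_Ints lattice_diff)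
  ultimately obtain k where k: "D = 2 * of_int k" by (metis Ints_cases)
  have "D > 0" "D \<noteq> 2" using pos \<open>cross ?d1 ?d2 \<noteq> 2\<close> by (auto simp: D_def)
  then have "k \<noteq> 1" "k > 0" using k by auto
  then have "2 \<le> k" by simp
  then have "4 \<le> D" using k by simp
  then have D: "D > 2" by simp
  obtain m where m: "2 *\<^sub>R m \<in> lattice" "cross ?d1 (m - v) = 1 / 2" "\<bar>cross ?d2 (m - v)\<bar> < D / 4"
    using half_point_beside_edge[OF e1(2,3) e2(2,3) y(1) e1(4) e2(4) y(2) D_def D
        open_edge_no_lattice_points[OF T2 vM e2(1,4)]] by blast
  note m1 = obstructing_midpoint[OF T1 T2 vM e1 e2 D_def D m]
  define m' where "m' = 2 *\<^sub>R v - m"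
  have e1': "edge_at T\<^sub>1 v = closed_segment b\<^sub>1 a\<^sub>1" "v = midpoint b\<^sub>1 a\<^sub>1"
    and e2': "edge_at T\<^sub>2 v = closed_segment b\<^sub>2 a\<^sub>2" "v = midpoint b\<^sub>2 a\<^sub>2"
    using e1 e2 by (auto simp: closed_segment_commute midpoint_sym)
  have D': "D = cross (a\<^sub>1 - b\<^sub>1) (a\<^sub>2 - b\<^sub>2)" by (simp add: D_def cross_def algebra_simps)
  have "2 *\<^sub>R v \<in> lattice" using vM by (simp add: edge_midpoints_def)
  then have "2 *\<^sub>R (2 *\<^sub>R v) - 2 *\<^sub>R m \<in> lattice" by (intro lattice_diff[OF lattice_scaleR m(1)]) simp_all
  then have "2 *\<^sub>R m' \<in> lattice" by (simp add: m'_def scaleR_diff_right)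
  moreover have "cross (a\<^sub>1 - b\<^sub>1) (m' - v) = cross ?d1 (m - v)" "cross (a\<^sub>2 - b\<^sub>2) (m' - v) = cross ?d2 (m - v)"
    by (simp_all add: m'_def cross_def algebra_simps)
  ultimately have m': "2 *\<^sub>R m' \<in> lattice" "cross (a\<^sub>1 - b\<^sub>1) (m' - v) = 1 / 2"
    "\<bar>cross (a\<^sub>2 - b\<^sub>2) (m' - v)\<bar> < D / 4"
    using m by auto
  note m2 = obstructing_midpoint[OF T1 T2 vM e1'(1) e1(3,2) e1'(2) e2'(1) e2(3,2) e2'(2) D' D m']
  have "sweep \<kappa> m + sweep \<kappa> m' = 2 * sweep \<kappa> v" by (simp add: m'_def sweep_def algebra_simps)
  moreover have "m \<noteq> v" using m(2) by (auto simp: cross_def)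
  then have "sweep \<kappa> m \<noteq> sweep \<kappa> v" using sweep_inj[OF irr] m1(1) vM by (auto dest: inj_onD)
  ultimately have "sweep \<kappa> m < sweep \<kappa> v \<or> sweep \<kappa> m' < sweep \<kappa> v" by linarith
  then show False using agree m1 m2 by blast
qed

lemma first_difference:
  assumes T1: "unimodular_triangulation P T\<^sub>1" and T2: "unimodular_triangulation P T\<^sub>2"
    and irr: "\<kappa> \<notin> \<rat>" and vM: "v \<in> edge_midpoints P"
    and agree: "\<And>u. u \<in> edge_midpoints P \<Longrightarrow> sweep \<kappa> u < sweep \<kappa> v \<Longrightarrow> edge_at T\<^sub>1 u = edge_at T\<^sub>2 u"
    and ne: "edge_at T\<^sub>1 v \<noteq> edge_at T\<^sub>2 v"
    and e1: "edge_at T\<^sub>1 v = closed_segment a\<^sub>1 b\<^sub>1" "a\<^sub>1 \<in> lattice" "b\<^sub>1 \<in> lattice" "v = midpoint a\<^sub>1 b\<^sub>1"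
    and e2: "edge_at T\<^sub>2 v = closed_segment a\<^sub>2 b\<^sub>2" "a\<^sub>2 \<in> lattice" "b\<^sub>2 \<in> lattice" "v = midpoint a\<^sub>2 b\<^sub>2"
    and y1: "y\<^sub>1 \<in> lattice" "cross (b\<^sub>1 - a\<^sub>1) y\<^sub>1 = 1"
    and y2: "y\<^sub>2 \<in> lattice" "cross (b\<^sub>2 - a\<^sub>2) y\<^sub>2 = 1"
  shows "\<bar>cross (b\<^sub>1 - a\<^sub>1) (b\<^sub>2 - a\<^sub>2)\<bar> = 2"
proof -
  have "cross (b\<^sub>1 - a\<^sub>1) (b\<^sub>2 - a\<^sub>2) \<noteq> 0"
    using cross_edges_nonzero[OF e1(2,3) e2(2,3) y1(1) y2(1) _ y1(2) y2(2)] e1 e2 ne by simp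
  then consider "cross (b\<^sub>1 - a\<^sub>1) (b\<^sub>2 - a\<^sub>2) > 0" | "cross (b\<^sub>1 - a\<^sub>1) (b\<^sub>2 - a\<^sub>2) < 0" by linarith
  then show ?thesis
  proof cases
    case 1
    then show ?thesis using first_difference_pos[OF T1 T2 irr vM agree e1 e2 y1] by simp
  next
    case 2
    have neg: "cross (b\<^sub>1 - a\<^sub>1) (a\<^sub>2 - b\<^sub>2) = - cross (b\<^sub>1 - a\<^sub>1) (b\<^sub>2 - a\<^sub>2)"
      by (simp add: cross_def algebra_simps)
    have "edge_at T\<^sub>2 v = closed_segment b\<^sub>2 a\<^sub>2" "v = midpoint b\<^sub>2 a\<^sub>2"
      using e2 by (auto simp: closed_segment_commute midpoint_sym)
    then show ?thesis
      using first_difference_pos[OF T1 T2 irr vM agree e1 _ e2(3,2) _ y1] 2 neg by simp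
  qed
qed

text \<open>Three different edges would have edge vectors with pairwise determinants \<open>\<plusminus>2\<close>. The linear
  relation between three vectors in the plane then reads \<open>\<plusminus>d\<^sub>1 \<plusminus> d\<^sub>2 \<plusminus> d\<^sub>3 = 0\<close>. As \<open>d\<^sub>1\<close> and \<open>d\<^sub>2\<close> are congruent
  modulo twice the lattice, \<open>d\<^sub>3\<close> would be divisible by 2, which contradicts primitivity.\<close>

lemma at_most_two_edges:
  assumes T1: "unimodular_triangulation P T\<^sub>1" and T2: "unimodular_triangulation P T\<^sub>2"
    and T3: "unimodular_triangulation P T\<^sub>3"
    and irr: "\<kappa> \<notin> \<rat>" and vM: "v \<in> edge_midpoints P"
    and agree: "\<And>u. u \<in> edge_midpoints P \<Longrightarrow> sweep \<kappa> u < sweep \<kappa> v \<Longrightarrow>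
      edge_at T\<^sub>1 u = edge_at T\<^sub>2 u \<and> edge_at T\<^sub>1 u = edge_at T\<^sub>3 u"
  shows "edge_at T\<^sub>1 v = edge_at T\<^sub>2 v \<or> edge_at T\<^sub>1 v = edge_at T\<^sub>3 v \<or> edge_at T\<^sub>2 v = edge_at T\<^sub>3 v"
proof (rule ccontr)
  assume contra: "\<not> ?thesis"
  obtain a\<^sub>1 b\<^sub>1 y\<^sub>1 where 1: "a\<^sub>1 \<in> lattice" "b\<^sub>1 \<in> lattice" "y\<^sub>1 \<in> lattice" "cross (b\<^sub>1 - a\<^sub>1) y\<^sub>1 = 1"
    "edge_at T\<^sub>1 v = closed_segment a\<^sub>1 b\<^sub>1" "v = midpoint a\<^sub>1 b\<^sub>1"
    using edge_at_obtain[OF T1 vM] by metis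
  obtain a\<^sub>2 b\<^sub>2 y\<^sub>2 where 2: "a\<^sub>2 \<in> lattice" "b\<^sub>2 \<in> lattice" "y\<^sub>2 \<in> lattice" "cross (b\<^sub>2 - a\<^sub>2) y\<^sub>2 = 1"
    "edge_at T\<^sub>2 v = closed_segment a\<^sub>2 b\<^sub>2" "v = midpoint a\<^sub>2 b\<^sub>2"
    using edge_at_obtain[OF T2 vM] by metis
  obtain a\<^sub>3 b\<^sub>3 y\<^sub>3 where 3: "a\<^sub>3 \<in> lattice" "b\<^sub>3 \<in> lattice" "y\<^sub>3 \<in> lattice" "cross (b\<^sub>3 - a\<^sub>3) y\<^sub>3 = 1"
    "edge_at T\<^sub>3 v = closed_segment a\<^sub>3 b\<^sub>3" "v = midpoint a\<^sub>3 b\<^sub>3"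
    using edge_at_obtain[OF T3 vM] by metis
  let ?d1 = "b\<^sub>1 - a\<^sub>1" and ?d2 = "b\<^sub>2 - a\<^sub>2" and ?d3 = "b\<^sub>3 - a\<^sub>3"
  have c12: "\<bar>cross ?d1 ?d2\<bar> = 2"
    using contra agree by (intro first_difference[OF T1 T2 irr vM _ _ 1(5,1,2,6) 2(5,1,2,6) 1(3,4) 2(3,4)]) auto
  have c13: "\<bar>cross ?d1 ?d3\<bar> = 2"
    using contra agree by (intro first_difference[OF T1 T3 irr vM _ _ 1(5,1,2,6) 3(5,1,2,6) 1(3,4) 3(3,4)]) auto
  have c23: "\<bar>cross ?d2 ?d3\<bar> = 2"
    using contra agree by (intro first_difference[OF T2 T3 irr vM _ _ 2(5,1,2,6) 3(5,1,2,6) 2(3,4) 3(3,4)]) force+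
  have id: "cross ?d2 ?d3 * cross ?d1 y\<^sub>3 - cross ?d1 ?d3 * cross ?d2 y\<^sub>3 + cross ?d1 ?d2 * cross ?d3 y\<^sub>3 = 0"
    by (simp add: cross_def algebra_simps)
  have "a\<^sub>1 + b\<^sub>1 = a\<^sub>2 + b\<^sub>2" using 1(6) 2(6) by (simp add: midpoint_def)
  then have "?d1 = ?d2 + 2 *\<^sub>R (a\<^sub>2 - a\<^sub>1)" by (auto simp: prod_eq_iff algebra_simps)
  then have par: "cross ?d1 y\<^sub>3 = cross ?d2 y\<^sub>3 + 2 * cross (a\<^sub>2 - a\<^sub>1) y\<^sub>3"
    by (simp only: cross_add cross_scaleR)
  obtain i j where ij: "cross ?d2 y\<^sub>3 = of_int i" "cross (a\<^sub>2 - a\<^sub>1) y\<^sub>3 = of_int j"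
    using 1 2 3 by (metis Ints_cases cross_Ints lattice_diff)
  have "cross ?d2 ?d3 \<in> {2, - 2}" "cross ?d1 ?d3 \<in> {2, - 2}" "cross ?d1 ?d2 \<in> {2, - 2}"
    using c12 c13 c23 by auto
  then have "real_of_int (2 * j) \<in> {1, -1} \<or> real_of_int (2 * i + 2 * j) \<in> {1, - 1}"
    using id unfolding par ij 3(4) by auto
  then have "2 * j = 1 \<or> 2 * j = - 1 \<or> 2 * i + 2 * j = 1 \<or> 2 * i + 2 * j = - 1" by force
  then show False by presburger
qed

section \<open>Counting by successive choices\<close>

lemma card_le_two_if_no_three:
  assumes "\<And>x y z. x \<in> A \<Longrightarrow> y \<in> A \<Longrightarrow> z \<in> A \<Longrightarrow> x = y \<or> x = z \<or> y = z"
  shows "finite A \<and> card A \<le> 2"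
proof -
  have "\<exists>x y. A \<subseteq> {x, y}" using assms by blast
  then obtain x y where A: "A \<subseteq> {x, y}" by blast
  then have "finite A" by (rule finite_subset) simp
  moreover have "card A \<le> card {x, y}" using A by (intro card_mono) auto
  moreover have "card {x, y} \<le> 2" by (cases "x = y") auto
  ultimately show ?thesis by linarith
qed

text \<open>Reading off the values of a function in increasing order of \<open>r\<close>, with at most two possibilities at each
  step, leaves at most \<open>2 ^ card M\<close> functions.\<close>

lemma card_decision_tree:
  fixes f :: "'x \<Rightarrow> 'm \<Rightarrow> 'e" and r :: "'m \<Rightarrow> real"
  assumes "finite M" "inj_on r M"
    and "\<And>v x y z. \<lbrakk>v \<in> M; x \<in> X; y \<in> X; z \<in> X;
        \<And>u. u \<in> M \<Longrightarrow> r u < r v \<Longrightarrow> f x u = f y u \<and> f x u = f z u\<rbrakk>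
      \<Longrightarrow> f x v = f y v \<or> f x v = f z v \<or> f y v = f z v"
  shows "finite ((\<lambda>x. restrict (f x) M) ` X) \<and> card ((\<lambda>x. restrict (f x) M) ` X) \<le> 2 ^ card M"
  using assms
proof (induction M rule: finite_ranking_induct[where f = r])
  case empty
  have sub: "(\<lambda>x. restrict (f x) {}) ` X \<subseteq> {\<lambda>u. undefined}" by auto
  then have "finite ((\<lambda>x. restrict (f x) {}) ` X)" by (rule finite_subset) simp
  moreover have "card ((\<lambda>x. restrict (f x) {}) ` X) \<le> 2 ^ card {}"
    by (rule order_trans[OF card_mono[OF _ sub]]) simp_all
  ultimately show ?case by (rule conjI)
next
  case (insert v S)
  show ?case
  proof (cases "v \<in> S")
    case True
    then have eq: "insert v S = S" by (rule insert_absorb)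
    show ?thesis using insert.prems unfolding eq by (rule insert.IH)
  next
    case False
    let ?F = "\<lambda>M. (\<lambda>x. restrict (f x) M) ` X"
    have lt: "r u < r v" if "u \<in> S" for u
      using insert.hyps(2)[OF that] insert.prems(1) that False
      by (metis inj_onD insertCI order_le_less)
    have IH: "finite (?F S) \<and> card (?F S) \<le> 2 ^ card S"
    proof (rule insert.IH)
      show "inj_on r S" using insert.prems(1) by (auto intro: inj_on_subset)
      fix w x y z
      assume w: "w \<in> S" "x \<in> X" "y \<in> X" "z \<in> X"
        and a: "\<And>u. u \<in> S \<Longrightarrow> r u < r w \<Longrightarrow> f x u = f y u \<and> f x u = f z u"
      show "f x w = f y w \<or> f x w = f z w \<or> f y w = f z w"
        using w a lt[OF w(1)] by (intro insert.prems(2)) auto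
    qed
    define fibre where "fibre g = {h \<in> ?F (insert v S). restrict h S = g}" for g
    have fibre: "finite (fibre g) \<and> card (fibre g) \<le> 2" for g
    proof (rule card_le_two_if_no_three)
      fix h1 h2 h3 assume h: "h1 \<in> fibre g" "h2 \<in> fibre g" "h3 \<in> fibre g"
      then obtain x y z where x: "x \<in> X" "h1 = restrict (f x) (insert v S)"
        and y: "y \<in> X" "h2 = restrict (f y) (insert v S)"
        and z: "z \<in> X" "h3 = restrict (f z) (insert v S)"
        by (auto simp: fibre_def)
      have "restrict h1 S = restrict h2 S" "restrict h1 S = restrict h3 S"
        using h by (auto simp: fibre_def)
      then have same: "f x u = f y u \<and> f x u = f z u" if "u \<in> S" for u
        using that unfolding x y z by (metis insertCI restrict_apply')
      have same': "f y u = f z u" if "u \<in> S" for u using same[OF that] by metis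
      have "f x v = f y v \<or> f x v = f z v \<or> f y v = f z v"
        using x y z same by (intro insert.prems(2)) auto
      then show "h1 = h2 \<or> h1 = h3 \<or> h2 = h3"
        using same same' unfolding x y z restrict_def fun_eq_iff by auto
    qed
    have sub: "?F (insert v S) \<subseteq> (\<Union>g\<in>?F S. fibre g)"
      by (auto simp: fibre_def image_iff restrict_def fun_eq_iff)
    have fin: "finite (\<Union>g\<in>?F S. fibre g)" using IH fibre by (intro finite_UN_I) blast+
    have "card (?F (insert v S)) \<le> card (\<Union>g\<in>?F S. fibre g)" by (rule card_mono[OF fin sub])
    also have "\<dots> \<le> (\<Sum>g\<in>?F S. card (fibre g))" using IH by (intro card_UN_le) auto
    also have "\<dots> \<le> (\<Sum>g\<in>?F S. 2)" using fibre by (intro sum_mono) auto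
    also have "\<dots> \<le> 2 ^ card (insert v S)" using IH False insert.hyps(1) by simp
    finally show ?thesis using finite_subset[OF sub fin] by blast
  qed
qed

section \<open>The upper bound\<close>

lemma finite_lattice_bounded:
  assumes "bounded S"
  shows "finite (S \<inter> lattice)"
proof -
  obtain B where B: "\<And>x. x \<in> S \<Longrightarrow> norm x \<le> B" using assms by (auto simp: bounded_iff)
  have "S \<inter> lattice \<subseteq> {k \<in> \<int>. \<bar>k\<bar> \<le> B} \<times> {k \<in> \<int>. \<bar>k\<bar> \<le> B}"
  proof
    fix x assume "x \<in> S \<inter> lattice"
    then show "x \<in> {k \<in> \<int>. \<bar>k\<bar> \<le> B} \<times> {k \<in> \<int>. \<bar>k\<bar> \<le> B}"
      using B[of x] norm_fst_le[of "fst x" "snd x"] norm_snd_le[of "snd x" "fst x"]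
      by (cases x) (auto simp: lattice_iff)
  qed
  then show ?thesis by (rule finite_subset) (intro finite_cartesian_product finite_abs_int_segment)
qed

lemma finite_edge_midpoints:
  assumes "bounded P"
  shows "finite (edge_midpoints P)"
proof -
  have "(\<lambda>v. 2 *\<^sub>R v) ` edge_midpoints P \<subseteq> (\<lambda>v. 2 *\<^sub>R v) ` P \<inter> lattice"
    using interior_subset by (auto simp: edge_midpoints_def)
  then have "finite ((\<lambda>v. 2 *\<^sub>R v) ` edge_midpoints P)"
    using finite_lattice_bounded[OF bounded_scaling[OF assms]] finite_subset by blast
  then show ?thesis by (rule finite_imageD) (auto simp: inj_on_def)
qed

lemma ex_irrational: "\<exists>x::real. x \<notin> \<rat>"
  using countable_rat uncountable_UNIV_real by (metis UNIV_eq_I)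

lemma card_unimodular_triangulations:
  assumes "bounded P"
  shows "finite {T. unimodular_triangulation P T}"
    and "card {T. unimodular_triangulation P T} \<le> 2 ^ card (edge_midpoints P)"
proof -
  let ?X = "{T. unimodular_triangulation P T}" and ?M = "edge_midpoints P"
  let ?f = "\<lambda>T. restrict (edge_at T) ?M"
  obtain \<kappa> :: real where irr: "\<kappa> \<notin> \<rat>" using ex_irrational by blast
  have *: "finite (?f ` ?X) \<and> card (?f ` ?X) \<le> 2 ^ card ?M"
  proof (rule card_decision_tree[OF finite_edge_midpoints[OF assms] sweep_inj[OF irr]])
    fix v T1 T2 T3
    assume "v \<in> ?M" "T1 \<in> ?X" "T2 \<in> ?X" "T3 \<in> ?X"
      and "\<And>u. u \<in> ?M \<Longrightarrow> sweep \<kappa> u < sweep \<kappa> v \<Longrightarrow>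
        edge_at T1 u = edge_at T2 u \<and> edge_at T1 u = edge_at T3 u"
    then show "edge_at T1 v = edge_at T2 v \<or> edge_at T1 v = edge_at T3 v \<or> edge_at T2 v = edge_at T3 v"
      by (intro at_most_two_edges[OF _ _ _ irr]) auto
  qed
  have inj: "inj_on ?f ?X"
  proof (rule inj_onI)
    fix T T' assume T: "T \<in> ?X" "T' \<in> ?X" and "?f T = ?f T'"
    then have "edge_at T v = edge_at T' v" if "v \<in> ?M" for v using that by (metis restrict_apply')
    then show "T = T'" using triangulation_eq_if_same_inner_edges T by blast
  qed
  show "finite ?X" using * inj finite_imageD by blast
  show "card ?X \<le> 2 ^ card ?M" using * card_image[OF inj] by simp
qed

text \<open>Doubling turns the midpoints into the integer points of \<open>(0, 2m) \<times> (0, 2n)\<close> whose coordinates are not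
  both even, of which there are \<open>(2m - 1)(2n - 1) - (m - 1)(n - 1)\<close>.\<close>

lemma card_edge_midpoints_grid:
  assumes "1 \<le> m" "1 \<le> n"
  shows "card (edge_midpoints (convex hull grid m n)) \<le> 3 * m * n - m - n"
proof -
  let ?A = "{1..2*m-1} \<times> {1..2*n-1}" and ?B = "(\<lambda>(i,j). (2*i, 2*j)) ` ({1..m-1} \<times> {1..n-1})"
  let ?h = "\<lambda>(i::nat, j::nat). (real i / 2, real j / 2)"
  have int: "interior (convex hull grid m n) = {0<..<real m} \<times> {0<..<real n}"
    using assms by (simp add: convex_hull_grid interior_Times)
  have "edge_midpoints (convex hull grid m n) \<subseteq> ?h ` (?A - ?B)"
  proof
    fix v assume "v \<in> edge_midpoints (convex hull grid m n)"
    then have v: "0 < fst v" "fst v < real m" "0 < snd v" "snd v < real n" "v \<notin> lattice" "2 *\<^sub>R v \<in> lattice"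
      by (auto simp: edge_midpoints_def int)
    then obtain i j :: int where ij: "2 * fst v = of_int i" "2 * snd v = of_int j"
      by (auto simp: lattice_iff elim!: Ints_cases)
    have "real_of_int 0 < of_int i" "real_of_int i < of_int (2 * int m)"
      "real_of_int 0 < of_int j" "real_of_int j < of_int (2 * int n)" using v ij by auto
    then have b: "0 < i" "i < 2 * int m" "0 < j" "j < 2 * int n" by linarith+
    have vh: "v = ?h (nat i, nat j)" using ij b by (simp add: prod_eq_iff)
    have "(nat i, nat j) \<in> ?A" using b by auto
    moreover have "(nat i, nat j) \<notin> ?B"
    proof
      assume "(nat i, nat j) \<in> ?B"
      then obtain k l where "nat i = 2 * k" "nat j = 2 * l" by auto
      then have "v = (real k, real l)" using vh by simp
      then show False using v(5) by (simp add: lattice_iff)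
    qed
    ultimately show "v \<in> ?h ` (?A - ?B)" using vh by blast
  qed
  then have "card (edge_midpoints (convex hull grid m n)) \<le> card (?A - ?B)"
    by (rule surj_card_le[rotated]) simp
  also have "\<dots> = card ?A - card ?B" using assms by (intro card_Diff_subset) auto
  also have "\<dots> = (2 * m - 1) * (2 * n - 1) - (m - 1) * (n - 1)"
    by (subst card_image) (auto simp: inj_on_def card_cartesian_product)
  also have "\<dots> = 3 * m * n - m - n"
  proof -
    obtain m' n' where "m = Suc m'" "n = Suc n'" using assms by (metis Suc_le_D One_nat_def)
    then show ?thesis by (simp add: algebra_simps)
  qed
  finally show ?thesis .
qed

theorem theorem1:
  shows "(\<forall>P. lattice_polygon P \<longrightarrow>
            finite {T. maximal_triangulation P T}
          \<and> {T. maximal_triangulation P T} = {T. unimodular_triangulation P T}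
          \<and> (\<forall>T. unimodular_triangulation P T \<longrightarrow>
                num_maximal_triangulations P \<le> 2 ^ card (inner_edges P T)))
       \<and> (\<forall>m n. 1 \<le> m \<and> 1 \<le> n \<longrightarrow>
            num_grid_triangulations m n \<le> 2 ^ (3 * m * n - m - n)
          \<and> (2::nat) ^ (3 * m * n - m - n) < 2 ^ (3 * m * n))"
proof (intro conjI allI impI; (elim conjE)?)
  fix P
  have eq: "{T. maximal_triangulation P T} = {T. unimodular_triangulation P T}"
    using maximal_imp_unimodular unimodular_imp_maximal by blast
  then show "{T. maximal_triangulation P T} = {T. unimodular_triangulation P T}" .
  show "finite {T. maximal_triangulation P T}"
  proof (cases "\<exists>T. unimodular_triangulation P T")
    case True
    then have "bounded P" using compact_region compact_imp_bounded by blast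
    then show ?thesis unfolding eq by (rule card_unimodular_triangulations)
  qed (simp add: eq)
  fix T assume T: "unimodular_triangulation P T"
  then have "bounded P" using compact_region compact_imp_bounded by blast
  then have "num_maximal_triangulations P \<le> 2 ^ card (edge_midpoints P)"
    unfolding num_maximal_triangulations_def eq by (rule card_unimodular_triangulations)
  also have "\<dots> \<le> 2 ^ card (inner_edges P T)"
    using card_edge_midpoints_le[OF T] by (intro power_increasing) auto
  finally show "num_maximal_triangulations P \<le> 2 ^ card (inner_edges P T)" .
next
  fix m n :: nat assume mn: "1 \<le> m" "1 \<le> n"
  have "bounded (convex hull grid m n)"
    by (intro bounded_convex_hull finite_imp_bounded) (simp add: grid_def)
  then have "num_grid_triangulations m n \<le> 2 ^ card (edge_midpoints (convex hull grid m n))"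
    unfolding num_grid_triangulations_def by (rule card_unimodular_triangulations)
  also have "\<dots> \<le> 2 ^ (3 * m * n - m - n)"
    using card_edge_midpoints_grid[OF mn] by (intro power_increasing) auto
  finally show "num_grid_triangulations m n \<le> 2 ^ (3 * m * n - m - n)" .
  have "0 < 3 * m * n" using mn by simp
  then show "(2::nat) ^ (3 * m * n - m - n) < 2 ^ (3 * m * n)"
    using mn by (intro power_strict_increasing) auto
qed

end
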